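(* Let $\mathcal D$ be a directed acyclic graph with finite vertex set $V$ and let $\sigma\in\mathbb S_1^+(\mathcal H_V)$. Let $$T_{\mathcal D}(\sigma)=\exp\Bigl\{\sum_{v\in V}\bigl(\log\sigma_{\{v\}\cup\operatorname{pa}(v)}-\log\sigma_{\operatorname{pa}(v)}\bigr)\Bigr\}.$$ Then $$e^{-gI(\mathcal D)_\sigma}\le\operatorname{Tr}\bigl(T_{\mathcal D}(\sigma)\bigr)\le 1.$$ If $\operatorname{Tr}(T_{\mathcal D}(\sigma))=1$, then $T_{\mathcal D}(\sigma)$ satisfies the directed Markov properties (O), (L) and (G) with respect to $\mathcal D$.
   Context: For each $v\in V$, $\mathcal H_v$ is a finite-dimensional complex Hilbert space; $\mathcal H_A=\bigotimes_{v\in A}\mathcal H_v$ for $A\subseteq V$, with $\mathcal H_\varnothing=\mathbb C$. $\mathbb S_1^+(\mathcal H_A)$ is the set of positive definite (self-adjoint) operators on $\mathcal H_A$ of trace one. For $A\subseteq V$, $\sigma_A=\operatorname{Tr}_{V\setminus A}(\sigma)$ is the marginal. All operators $\log\sigma_A$ are embedded into operators on $\mathcal H_V$ by tensoring with the identity on the complementary factors, and $\log\sigma_\varnothing=0$. The von Neumann entropy is $\operatorname S(A)_\sigma=-\operatorname{Tr}(\sigma_A\log\sigma_A)$, with $\operatorname S(\varnothing)_\sigma=0$; for disjoint $A,B$, $\operatorname S(A\mid B)_\sigma=\operatorname S(A\cup B)_\sigma-\operatorname S(B)_\sigma$. The excess global information is $gI(\mathcal D)_\sigma=\sum_{v\in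 V}\operatorname S(v\mid\operatorname{pa}(v))_\sigma-\operatorname S(V)_\sigma$. For a state $\rho\in\mathbb S_1^+(\mathcal H_V)$ and pairwise disjoint $A,B,C\subseteq V$, $I(A:B\mid C)_\rho=\operatorname S(A\cup C)_\rho+\operatorname S(B\cup C)_\rho-\operatorname S(C)_\rho-\operatorname S(A\cup B\cup C)_\rho$, and $A\perp\!\!\!\perp_Q B\mid C$ (with respect to $\rho$) means $I(A:B\mid C)_\rho=0$. For a vertex $v$ of $\mathcal D$: $\operatorname{pa}(v)$ is its set of parents, $\operatorname{de}(v)$ its set of descendants (excluding $v$), $\operatorname{nd}(v)=V\setminus(\{v\}\cup\operatorname{de}(v))$. A total ordering $<$ of $V$ is topological if $u<w$ for every arrow $u\to w$; $\operatorname{pr}(v)=\{u\in V:u<v\}$. A walk (repeated vertices allowed, arrows traversable in either direction) has a collider at a non-endpoint $\alpha_i$ if $\alpha_{i-1}\to\alpha_i\leftarrow\alpha_{i+1}$. A walk is active relative to $S$ if every non-collider on it is outside $S$ and every collider on it is in $S$; otherwise it is blocked by $S$. Disjoint $A,B$ are $d$-separated by $S$ if every walk from $A$ to $B$ is blocked by $S$. Markov properties of a state: (O), for a topological ordering: $v\perp\!\!\!\perp_Q(\operatorname{pr}(v)\setminus\operatorname{pa}(v))\mid\operatorname{pa}(v)$ for all $v\in V$ (here: for every topological ordering). (L): $v\perp\!\!\!\perp_Q(\operatorname{nd}(v)\setminus\operatorname{pa}(v))\mid\operatorname{pa}(v)$ for all $v\in V$. (G): for all pairwise disjoint $A,B,S\subseteq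 V$, if $A,B$ are $d$-separated by $S$ then $A\perp\!\!\!\perp_Q B\mid S$. *)

theory Defs
  imports "HOL-Library.FuncSet" "HOL-Library.Countable_Set" "Jordan_Normal_Form.Schur_Decomposition"
begin

section \<open>Matrices\<close>

definition mat_trace :: "complex mat \<Rightarrow> complex" where
  "mat_trace A = (\<Sum>i<dim_row A. A $$ (i, i))"

definition hermitian :: "complex mat \<Rightarrow> bool" where
  "hermitian A \<longleftrightarrow> mat_adjoint A = A"

definition unitary :: "nat \<Rightarrow> complex mat \<Rightarrow> bool" where
  "unitary n U \<longleftrightarrow> U \<in> carrier_mat n n \<and> mat_adjoint U * U = 1\<^sub>m n"

text \<open>Order on the complex numbers: \<open>0 < z\<close> means that \<open>z\<close> is real and positive.\<close>

definition positive_definite :: "nat \<Rightarrow> complex mat \<Rightarrow> bool" where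
  "positive_definite n A \<longleftrightarrow> A \<in> carrier_mat n n \<and> hermitian A \<and>
     (\<forall>v \<in> carrier_vec n. v \<noteq> 0\<^sub>v n \<longrightarrow> 0 < (A *\<^sub>v v) \<bullet>c v)"

text \<open>The exponential power series; convergence is entrywise.\<close>

definition mat_exp :: "complex mat \<Rightarrow> complex mat" where
  "mat_exp A = mat (dim_row A) (dim_row A) (\<lambda>ij. \<Sum>k. (A ^\<^sub>m k) $$ ij / fact k)"

text \<open>The logarithm of a positive definite matrix, by functional calculus: the logarithm is applied
  to the eigenvalues in a spectral decomposition. By \<open>mat_log_spectral\<close> below, the result does not
  depend on the decomposition.\<close>

definition is_mat_log :: "complex mat \<Rightarrow> complex mat \<Rightarrow> bool" where
  "is_mat_log A L \<longleftrightarrow> (\<exists>U l. unitary (dim_row A) U \<and> (\<forall>i < dim_row A. 0 < l i) \<and>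
     A = U * mat_diag (dim_row A) (\<lambda>i. complex_of_real (l i)) * mat_adjoint U \<and>
     L = U * mat_diag (dim_row A) (\<lambda>i. complex_of_real (ln (l i))) * mat_adjoint U)"

definition mat_log :: "complex mat \<Rightarrow> complex mat" where
  "mat_log A = (THE L. is_mat_log A L)"

lemma mat_adjoint_carrier: "U \<in> carrier_mat n n \<Longrightarrow> mat_adjoint U \<in> carrier_mat n n"
  by (auto simp: mat_adjoint_def)

lemma is_mat_log_unique:
  assumes "is_mat_log A L" and "is_mat_log A M"
  shows "L = M"
proof -
  define n where "n = dim_row A"
  obtain U l where U: "unitary n U" "\<forall>i<n. 0 < l i"
    and A1: "A = U * mat_diag n (\<lambda>i. complex_of_real (l i)) * mat_adjoint U"
    and L: "L = U * mat_diag n (\<lambda>i. complex_of_real (ln (l i))) * mat_adjoint U"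
    using assms(1) unfolding is_mat_log_def n_def by blast
  obtain W m where W: "unitary n W" "\<forall>i<n. 0 < m i"
    and A2: "A = W * mat_diag n (\<lambda>i. complex_of_real (m i)) * mat_adjoint W"
    and M: "M = W * mat_diag n (\<lambda>i. complex_of_real (ln (m i))) * mat_adjoint W"
    using assms(2) unfolding is_mat_log_def n_def by blast
  define D where "D = mat_diag n (\<lambda>i. complex_of_real (l i))"
  define D' where "D' = mat_diag n (\<lambda>i. complex_of_real (ln (l i)))"
  define F where "F = mat_diag n (\<lambda>i. complex_of_real (m i))"
  define F' where "F' = mat_diag n (\<lambda>i. complex_of_real (ln (m i)))"
  define U' where "U' = mat_adjoint U"
  define W' where "W' = mat_adjoint W"
  have c [simp]: "U \<in> carrier_mat n n" "W \<in> carrier_mat n n" "U' \<in> carrier_mat n n"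
    "W' \<in> carrier_mat n n" "D \<in> carrier_mat n n" "D' \<in> carrier_mat n n"
    "F \<in> carrier_mat n n" "F' \<in> carrier_mat n n"
    using U W mat_adjoint_carrier
    by (auto simp: unitary_def U'_def W'_def D_def D'_def F_def F'_def)
  have UU: "U' * U = 1\<^sub>m n" "U * U' = 1\<^sub>m n" and WW: "W' * W = 1\<^sub>m n" "W * W' = 1\<^sub>m n"
    using U W mat_mult_left_right_inverse[of U' n U] mat_mult_left_right_inverse[of W' n W] c
    by (auto simp: unitary_def U'_def W'_def)
  define Z where "Z = W' * U"
  have Z [simp]: "Z \<in> carrier_mat n n" by (simp add: Z_def mult_carrier_mat[of _ n n])
  note cs = mult_carrier_mat[of _ n n _ n]
  note as = assoc_mult_mat[of _ n n _ n _ n]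
  have "U * D * U' = W * F * W'" using A1 A2 by (simp add: D_def F_def U'_def W'_def)
  hence "W' * (U * D * U') * U = W' * (W * F * W') * U" by simp
  moreover have "W' * (U * D * U') * U = Z * D * (U' * U)"
    unfolding Z_def by (simp add: cs as)
  moreover have "W' * (W * F * W') * U = (W' * W) * F * Z"
    unfolding Z_def by (simp add: cs as)
  ultimately have ZD: "Z * D = F * Z" using UU WW by (simp add: cs left_mult_one_mat[of _ n n] right_mult_one_mat[of _ n n])
  have ZD': "Z * D' = F' * Z"
  proof (rule eq_matI)
    fix i j assume "i < dim_row (F' * Z)" "j < dim_col (F' * Z)"
    hence ij: "i < n" "j < n" using carrier_matD[OF Z] by (auto simp: F'_def mat_diag_def)
    have "(Z * D) $$ (i,j) = Z $$ (i,j) * complex_of_real (l j)"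
      unfolding D_def using ij by (simp add: mat_diag_mult_right[OF Z])
    moreover have "(F * Z) $$ (i,j) = complex_of_real (m i) * Z $$ (i,j)"
      unfolding F_def using ij by (simp add: mat_diag_mult_left[OF Z])
    ultimately have "Z $$ (i,j) = 0 \<or> l j = m i" using ZD by auto
    then show "(Z * D') $$ (i,j) = (F' * Z) $$ (i,j)"
      unfolding D'_def F'_def using ij
      by (auto simp: mat_diag_mult_left[OF Z] mat_diag_mult_right[OF Z])
  qed (use carrier_matD[OF Z] in \<open>auto simp: D'_def F'_def mat_diag_def\<close>)
  have "L = W * (Z * D') * U'"
  proof -
    have "W * (Z * D') * U' = (W * W') * (U * D' * U')" unfolding Z_def by (simp add: cs as)
    then show ?thesis using L[folded D'_def U'_def] WW by (simp add: cs left_mult_one_mat[of _ n n])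
  qed
  moreover have "M = W * (F' * Z) * U'"
  proof -
    have "W * (F' * Z) * U' = (W * F' * W') * (U * U')" unfolding Z_def by (simp add: cs as)
    then show ?thesis using M[folded F'_def W'_def] UU by (simp add: cs right_mult_one_mat[of _ n n])
  qed
  ultimately show ?thesis using ZD' by simp
qed

lemma mat_log_spectral:
  assumes "unitary n U" and "\<And>i. i < n \<Longrightarrow> 0 < l i"
  shows "mat_log (U * mat_diag n (\<lambda>i. complex_of_real (l i)) * mat_adjoint U)
           = U * mat_diag n (\<lambda>i. complex_of_real (ln (l i))) * mat_adjoint U"
proof -
  have "dim_row (U * mat_diag n (\<lambda>i. complex_of_real (l i)) * mat_adjoint U) = n"
    using assms(1) by (auto simp: unitary_def)
  then have "is_mat_log (U * mat_diag n (\<lambda>i. complex_of_real (l i)) * mat_adjoint U)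
     (U * mat_diag n (\<lambda>i. complex_of_real (ln (l i))) * mat_adjoint U)"
    unfolding is_mat_log_def using assms by auto
  then show ?thesis unfolding mat_log_def using is_mat_log_unique by blast
qed


section \<open>Tensor products, marginals and embeddings\<close>

text \<open>The space at the vertex \<open>v\<close> is \<open>\<complex>\<^sup>d\<close> with \<open>d = d v\<close>, i.e. a finite-dimensional Hilbert space with
  a chosen orthonormal basis labelled by \<open>{..<d v}\<close>. The product basis of the tensor product over
  \<open>A\<close> is then labelled by \<open>cfg d A\<close>; for \<open>A = {}\<close> this is a singleton, so that \<open>\<H>\<^sub>A\<close> is the field of
  complex numbers. Operators are matrices in the product basis, which is listed in the (arbitrary
  but fixed) order given by \<open>from_nat_into\<close>, with inverse \<open>to_nat_on\<close>. No lower bound on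
  \<open>d v\<close> is needed: there is no state if \<open>d v = 0\<close> for some \<open>v \<in> V\<close>.\<close>

definition cfg :: "('v \<Rightarrow> nat) \<Rightarrow> 'v set \<Rightarrow> ('v \<Rightarrow> nat) set" where
  "cfg d A = (\<Pi>\<^sub>E v\<in>A. {..<d v})"

definition hdim :: "('v \<Rightarrow> nat) \<Rightarrow> 'v set \<Rightarrow> nat" where
  "hdim d A = card (cfg d A)"

definition label :: "('v \<Rightarrow> nat) \<Rightarrow> 'v set \<Rightarrow> nat \<Rightarrow> 'v \<Rightarrow> nat" where
  "label d A i = from_nat_into (cfg d A) i"

definition index :: "('v \<Rightarrow> nat) \<Rightarrow> 'v set \<Rightarrow> ('v \<Rightarrow> nat) \<Rightarrow> nat" where
  "index d A x = to_nat_on (cfg d A) x"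

definition states :: "('v \<Rightarrow> nat) \<Rightarrow> 'v set \<Rightarrow> complex mat set" where
  "states d A = {\<rho>. positive_definite (hdim d A) \<rho> \<and> mat_trace \<rho> = 1}"

text \<open>Partial trace over the factors in \<open>V - A\<close>. Here \<open>override_on z x A\<close> is the configuration that
  is \<open>x\<close> on \<open>A\<close> and \<open>z\<close> on \<open>V - A\<close>.\<close>

definition marginal :: "('v \<Rightarrow> nat) \<Rightarrow> 'v set \<Rightarrow> complex mat \<Rightarrow> 'v set \<Rightarrow> complex mat" where
  "marginal d V \<rho> A = mat (hdim d A) (hdim d A) (\<lambda>(i, j).
     \<Sum>z \<in> cfg d (V - A). \<rho> $$ (index d V (override_on z (label d A i) A),
                                 index d V (override_on z (label d A j) A)))"

text \<open>The operator \<open>M \<otimes> 1\<close> on \<open>\<H>\<^sub>V\<close>, for an operator \<open>M\<close> on \<open>\<H>\<^sub>A\<close>.\<close>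

definition embed :: "('v \<Rightarrow> nat) \<Rightarrow> 'v set \<Rightarrow> 'v set \<Rightarrow> complex mat \<Rightarrow> complex mat" where
  "embed d V A M = mat (hdim d V) (hdim d V) (\<lambda>(i, j).
     if \<forall>v \<in> V - A. label d V i v = label d V j v
     then M $$ (index d A (restrict (label d V i) A), index d A (restrict (label d V j) A))
     else 0)"


section \<open>Entropies\<close>

text \<open>The trace below is real for every state. For \<open>A = {}\<close> the marginal of a state is the \<open>1 \<times> 1\<close>
  identity, so its logarithm and its entropy are zero, as required by the usual conventions.\<close>

definition entropy :: "('v \<Rightarrow> nat) \<Rightarrow> 'v set \<Rightarrow> complex mat \<Rightarrow> 'v set \<Rightarrow> real" where
  "entropy d V \<rho> A = - Re (mat_trace (marginal d V \<rho> A * mat_log (marginal d V \<rho> A)))"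

definition cond_entropy :: "('v \<Rightarrow> nat) \<Rightarrow> 'v set \<Rightarrow> complex mat \<Rightarrow> 'v set \<Rightarrow> 'v set \<Rightarrow> real" where
  "cond_entropy d V \<rho> A B = entropy d V \<rho> (A \<union> B) - entropy d V \<rho> B"

definition cond_mutual_info ::
  "('v \<Rightarrow> nat) \<Rightarrow> 'v set \<Rightarrow> complex mat \<Rightarrow> 'v set \<Rightarrow> 'v set \<Rightarrow> 'v set \<Rightarrow> real" where
  "cond_mutual_info d V \<rho> A B C =
     entropy d V \<rho> (A \<union> C) + entropy d V \<rho> (B \<union> C) - entropy d V \<rho> C - entropy d V \<rho> (A \<union> B \<union> C)"

definition cond_indep ::
  "('v \<Rightarrow> nat) \<Rightarrow> 'v set \<Rightarrow> complex mat \<Rightarrow> 'v set \<Rightarrow> 'v set \<Rightarrow> 'v set \<Rightarrow> bool" where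
  "cond_indep d V \<rho> A B C \<longleftrightarrow> cond_mutual_info d V \<rho> A B C = 0"


section \<open>Directed acyclic graphs\<close>

text \<open>A directed graph is a vertex set \<open>V\<close> with a set \<open>E\<close> of arrows; \<open>(u, w) \<in> E\<close> is the arrow from
  \<open>u\<close> to \<open>w\<close>.\<close>

definition dag :: "'v set \<Rightarrow> ('v \<times> 'v) set \<Rightarrow> bool" where
  "dag V E \<longleftrightarrow> finite V \<and> E \<subseteq> V \<times> V \<and> acyclic E"

definition parents :: "('v \<times> 'v) set \<Rightarrow> 'v \<Rightarrow> 'v set" where
  "parents E v = {u. (u, v) \<in> E}"

definition descendants :: "('v \<times> 'v) set \<Rightarrow> 'v \<Rightarrow> 'v set" where
  "descendants E v = {w. (v, w) \<in> E\<^sup>+}"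

definition nondescendants :: "'v set \<Rightarrow> ('v \<times> 'v) set \<Rightarrow> 'v \<Rightarrow> 'v set" where
  "nondescendants V E v = V - ({v} \<union> descendants E v)"

text \<open>\<open>r\<close> is the strict order: \<open>(u, w) \<in> r\<close> means \<open>u < w\<close>.\<close>

definition topological_ordering :: "'v set \<Rightarrow> ('v \<times> 'v) set \<Rightarrow> ('v \<times> 'v) set \<Rightarrow> bool" where
  "topological_ordering V E r \<longleftrightarrow> r \<subseteq> V \<times> V \<and> strict_linear_order_on V r \<and> E \<subseteq> r"

definition predecessors :: "'v set \<Rightarrow> ('v \<times> 'v) set \<Rightarrow> 'v \<Rightarrow> 'v set" where
  "predecessors V r v = {u \<in> V. (u, v) \<in> r}"

text \<open>In an acyclic graph there is at most one arrow between two vertices, so a walk is determined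
  by its sequence of vertices.\<close>

definition walk :: "'v set \<Rightarrow> ('v \<times> 'v) set \<Rightarrow> 'v list \<Rightarrow> bool" where
  "walk V E w \<longleftrightarrow> w \<noteq> [] \<and> set w \<subseteq> V \<and>
     (\<forall>i. Suc i < length w \<longrightarrow> (w ! i, w ! Suc i) \<in> E \<or> (w ! Suc i, w ! i) \<in> E)"

definition collider :: "('v \<times> 'v) set \<Rightarrow> 'v list \<Rightarrow> nat \<Rightarrow> bool" where
  "collider E w i \<longleftrightarrow> 0 < i \<and> Suc i < length w \<and>
     (w ! (i - 1), w ! i) \<in> E \<and> (w ! Suc i, w ! i) \<in> E"

definition active :: "('v \<times> 'v) set \<Rightarrow> 'v set \<Rightarrow> 'v list \<Rightarrow> bool" where
  "active E S w \<longleftrightarrow>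
     (\<forall>i < length w. (\<not> collider E w i \<longrightarrow> w ! i \<notin> S) \<and> (collider E w i \<longrightarrow> w ! i \<in> S))"

definition d_separated ::
  "'v set \<Rightarrow> ('v \<times> 'v) set \<Rightarrow> 'v set \<Rightarrow> 'v set \<Rightarrow> 'v set \<Rightarrow> bool" where
  "d_separated V E A B S \<longleftrightarrow>
     (\<forall>w. walk V E w \<and> hd w \<in> A \<and> last w \<in> B \<longrightarrow> \<not> active E S w)"


section \<open>Markov properties, excess global information, and the operator\<close>

definition ordered_markov ::
  "('v \<Rightarrow> nat) \<Rightarrow> 'v set \<Rightarrow> ('v \<times> 'v) set \<Rightarrow> ('v \<times> 'v) set \<Rightarrow> complex mat \<Rightarrow> bool" where
  "ordered_markov d V E r \<rho> \<longleftrightarrow>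
     (\<forall>v \<in> V. cond_indep d V \<rho> {v} (predecessors V r v - parents E v) (parents E v))"

definition local_markov ::
  "('v \<Rightarrow> nat) \<Rightarrow> 'v set \<Rightarrow> ('v \<times> 'v) set \<Rightarrow> complex mat \<Rightarrow> bool" where
  "local_markov d V E \<rho> \<longleftrightarrow>
     (\<forall>v \<in> V. cond_indep d V \<rho> {v} (nondescendants V E v - parents E v) (parents E v))"

definition global_markov ::
  "('v \<Rightarrow> nat) \<Rightarrow> 'v set \<Rightarrow> ('v \<times> 'v) set \<Rightarrow> complex mat \<Rightarrow> bool" where
  "global_markov d V E \<rho> \<longleftrightarrow>
     (\<forall>A B S. A \<subseteq> V \<and> B \<subseteq> V \<and> S \<subseteq> V \<and> A \<inter> B = {} \<and> A \<inter> S = {} \<and> B \<inter> S = {} \<and>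
        d_separated V E A B S \<longrightarrow> cond_indep d V \<rho> A B S)"

definition excess_info ::
  "('v \<Rightarrow> nat) \<Rightarrow> 'v set \<Rightarrow> ('v \<times> 'v) set \<Rightarrow> complex mat \<Rightarrow> real" where
  "excess_info d V E \<sigma> =
     (\<Sum>v\<in>V. cond_entropy d V \<sigma> {v} (parents E v)) - entropy d V \<sigma> V"

definition log_marginal ::
  "('v \<Rightarrow> nat) \<Rightarrow> 'v set \<Rightarrow> complex mat \<Rightarrow> 'v set \<Rightarrow> complex mat" where
  "log_marginal d V \<sigma> A = embed d V A (mat_log (marginal d V \<sigma> A))"

text \<open>Matrices of a fixed size do not form a type, so the sum over \<open>V\<close> is written entrywise.\<close>

definition T_op ::
  "('v \<Rightarrow> nat) \<Rightarrow> 'v set \<Rightarrow> ('v \<times> 'v) set \<Rightarrow> complex mat \<Rightarrow> complex mat" where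
  "T_op d V E \<sigma> = mat_exp (mat (hdim d V) (hdim d V) (\<lambda>ij.
     \<Sum>v\<in>V. (log_marginal d V \<sigma> ({v} \<union> parents E v) - log_marginal d V \<sigma> (parents E v)) $$ ij))"

end

theory Submission
  imports Defs
begin

text \<open>Write \<open>T = exp H\<close>. The Gibbs variational principle says that \<open>ln (Tr (exp H))\<close> is the maximum of
  \<open>Tr (\<rho> H) + S(\<rho>)\<close> over all states \<open>\<rho>\<close>, attained at \<open>exp H / Tr (exp H)\<close>. Taking \<open>\<rho> = \<sigma>\<close> gives the
  lower bound. For any \<open>\<rho>\<close>, monotonicity of the relative entropy from \<open>{v} \<union> pa(v)\<close> to \<open>pa(v)\<close>, summed
  over \<open>v\<close>, gives \<open>Tr (\<rho> H) + S(\<rho>) \<le> S(V)\<^sub>\<rho> - (\<Sum>v. S(v|pa(v))\<^sub>\<rho>)\<close>, which is at most \<open>0\<close> by strong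
  subadditivity. If \<open>Tr T = 1\<close> then \<open>T\<close> itself is the maximiser, so every instance of strong
  subadditivity used is an equality for \<open>T\<close>; these equalities are conditional independences that
  imply all the Markov properties.

  Monotonicity of the relative entropy is obtained from the integral representation of the
  logarithm: the resolvent quantities \<open>\<langle>\<rho>, (L\<^sub>\<sigma> + t R\<^sub>\<rho>)\<^sup>-\<^sup>1 \<rho>\<rangle>\<close> are maxima of quadratic functionals
  over all test operators, and operators on a marginal yield only some of the test operators.\<close>

section \<open>Adjoint, trace and spectral decomposition\<close>

text \<open>The summands of H need not commute, so Tr(exp H) does not factor along the graph. The
  variational principle replaces it by expressions linear in H, and each of these reads only a
  marginal, since \<open>Tr (\<rho> (M \<otimes> 1)) = Tr (\<rho>\<^sub>A M)\<close>. The same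
  duality makes the quadratic functionals suitable for monotonicity: the two operators enter them
  linearly, and X \<mapsto> X \<otimes> 1 preserves products and adjoints. Strong subadditivity is
  the instance in which the reference is a marginal extended by the identity; such a reference does
  not have trace one in general, so relative entropy is treated for positive definite operators. The
  bound on S(V) can be built up along every chain of parent-closed sets. Equality therefore holds
  along all of these chains at once, and the choice of the chain gives (O) and (L). For (G), a
  separation lemma is proved by removing sinks, for triples that fill an ancestral set; d-separated
  sets are enlarged to such a triple by collecting the vertices that active walks from A
  reach.\<close>

lemma dim_mat_adjoint [simp]:
  "dim_row (mat_adjoint A) = dim_col A" "dim_col (mat_adjoint A) = dim_row A"
  by (auto simp: mat_adjoint_def)

lemma index_mat_adjoint [simp]:
  "i < dim_col A \<Longrightarrow> j < dim_row A \<Longrightarrow> mat_adjoint A $$ (i, j) = cnj (A $$ (j, i))"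
  by (auto simp: mat_adjoint_def mat_of_rows_def)

lemma mat_adjoint_adjoint [simp]: "mat_adjoint (mat_adjoint (A :: complex mat)) = A"
  by (rule eq_matI) auto

lemma mat_adjoint_mult:
  assumes "A \<in> carrier_mat n m" "B \<in> carrier_mat m k"
  shows "mat_adjoint (A * B) = mat_adjoint B * mat_adjoint (A :: complex mat)"
  by (rule eq_matI) (use assms in \<open>auto simp: scalar_prod_def mult.commute\<close>)

lemma mat_trace_mult:
  assumes "A \<in> carrier_mat n m" "B \<in> carrier_mat m n"
  shows "mat_trace (A * B) = (\<Sum>i<n. \<Sum>j<m. A $$ (i, j) * B $$ (j, i))"
  using assms by (auto simp: mat_trace_def scalar_prod_def atLeast0LessThan intro!: sum.cong)

lemma mat_trace_commute:
  assumes "A \<in> carrier_mat n m" "B \<in> carrier_mat m n"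
  shows "mat_trace (A * B) = mat_trace (B * A)"
  using sum.swap[of "\<lambda>i j. A $$ (i, j) * B $$ (j, i)" "{..<m}" "{..<n}"]
  by (simp add: mat_trace_mult[OF assms] mat_trace_mult[OF assms(2,1)] mult.commute)

section \<open>Unitary matrices\<close>

lemma unitary_carrier: "unitary n U \<Longrightarrow> U \<in> carrier_mat n n"
  by (simp add: unitary_def)

lemma unitary_adjoint_mult: "unitary n U \<Longrightarrow> mat_adjoint U * U = 1\<^sub>m n"
  by (simp add: unitary_def)

lemma unitary_mult_adjoint: "unitary n U \<Longrightarrow> U * mat_adjoint U = 1\<^sub>m n"
  using mat_mult_left_right_inverse[of "mat_adjoint U" n U]
  by (simp add: unitary_def mat_adjoint_carrier)

lemma unitary_cancel:
  assumes "unitary n U" "X \<in> carrier_mat n n"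
  shows "U * (mat_adjoint U * X) = X" "mat_adjoint U * (U * X) = X"
proof -
  have c: "U \<in> carrier_mat n n" "mat_adjoint U \<in> carrier_mat n n"
    using assms(1) by (auto simp: unitary_def mat_adjoint_carrier)
  show "U * (mat_adjoint U * X) = X"
    using assoc_mult_mat[OF c(1,2) assms(2)] assms by (simp add: unitary_mult_adjoint)
  show "mat_adjoint U * (U * X) = X"
    using assoc_mult_mat[OF c(2,1) assms(2)] assms by (simp add: unitary_adjoint_mult)
qed

lemma unitary_mult:
  assumes "unitary n U" "unitary n W"
  shows "unitary n (U * W)"
proof -
  have c: "U \<in> carrier_mat n n" "mat_adjoint U \<in> carrier_mat n n"
      "W \<in> carrier_mat n n" "mat_adjoint W \<in> carrier_mat n n"
    using assms by (auto simp: unitary_def mat_adjoint_carrier)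
  then show ?thesis
    using assms unitary_cancel(2)[OF assms(1), of W]
    by (auto simp: unitary_def mat_adjoint_mult[of _ n n _ n] assoc_mult_mat[of _ n n _ n _ n]
        mult_carrier_mat[of _ n n _ n])
qed

lemma mat_trace_conjugate:
  assumes "unitary n U" "X \<in> carrier_mat n n"
  shows "mat_trace (U * X * mat_adjoint U) = mat_trace X"
proof -
  have c: "U \<in> carrier_mat n n" "mat_adjoint U \<in> carrier_mat n n"
    using assms(1) by (auto simp: unitary_def mat_adjoint_carrier)
  have "mat_trace (U * X * mat_adjoint U) = mat_trace (mat_adjoint U * (U * X))"
    by (rule mat_trace_commute[of _ n n]) (use c assms in \<open>auto simp: mult_carrier_mat[of _ n n _ n]\<close>)
  then show ?thesis using assms by (simp add: unitary_cancel)
qed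

text \<open>With the eigenbasis \<open>U\<close> fixed, \<open>f\<close> ranges over the functional
  calculus: products, powers, traces, logarithms and exponentials reduce to operations on the values
  of \<open>f\<close>.\<close>

definition spectral_mat :: "nat \<Rightarrow> complex mat \<Rightarrow> (nat \<Rightarrow> real) \<Rightarrow> complex mat" where
  "spectral_mat n U f = U * mat_diag n (\<lambda>i. complex_of_real (f i)) * mat_adjoint U"

lemma dim_spectral_mat [simp]:
  "dim_row (spectral_mat n U f) = dim_row U" "dim_col (spectral_mat n U f) = dim_row U"
  by (simp_all add: spectral_mat_def)

lemma spectral_mat_carrier [simp]:
  "U \<in> carrier_mat n n \<Longrightarrow> spectral_mat n U f \<in> carrier_mat n n"
  using mat_adjoint_carrier[of U n] unfolding spectral_mat_def
  by (intro mult_carrier_mat[of _ n n]) auto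

lemma index_spectral_mat:
  assumes "U \<in> carrier_mat n n" "i < n" "j < n"
  shows "spectral_mat n U f $$ (i, j) = (\<Sum>k<n. U $$ (i, k) * f k * cnj (U $$ (j, k)))"
  using assms
  by (auto simp: spectral_mat_def mat_diag_mult_right[of _ n n] scalar_prod_def atLeast0LessThan
      intro!: sum.cong)

lemma hermitian_spectral_mat:
  assumes "U \<in> carrier_mat n n"
  shows "hermitian (spectral_mat n U f)"
  unfolding hermitian_def
proof (rule eq_matI)
  fix i j assume "i < dim_row (spectral_mat n U f)" "j < dim_col (spectral_mat n U f)"
  then have "i < n" "j < n" using spectral_mat_carrier[OF assms, of f] by auto
  then show "mat_adjoint (spectral_mat n U f) $$ (i, j) = spectral_mat n U f $$ (i, j)"
    using spectral_mat_carrier[OF assms, of f] assms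
    by (simp add: index_spectral_mat mult.commute mult.left_commute)
qed (use spectral_mat_carrier[OF assms, of f] in auto)

lemma mat_trace_spectral_mat:
  assumes "unitary n U"
  shows "mat_trace (spectral_mat n U f) = complex_of_real (\<Sum>i<n. f i)"
  unfolding spectral_mat_def by (subst mat_trace_conjugate[OF assms]) (auto simp: mat_trace_def mat_diag_def)

lemma spectral_mat_mult:
  assumes "unitary n U"
  shows "spectral_mat n U f * spectral_mat n U g = spectral_mat n U (\<lambda>i. f i * g i)"
proof -
  let ?F = "mat_diag n (\<lambda>i. complex_of_real (f i))" and ?G = "mat_diag n (\<lambda>i. complex_of_real (g i))"
  have c: "U \<in> carrier_mat n n" "mat_adjoint U \<in> carrier_mat n n" "?F \<in> carrier_mat n n"
      "?G \<in> carrier_mat n n"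
    using assms(1) by (auto simp: unitary_def mat_adjoint_carrier)
  have "spectral_mat n U f * spectral_mat n U g = U * (?F * ?G) * mat_adjoint U"
    using c unfolding spectral_mat_def
    by (simp add: assoc_mult_mat[of _ n n _ n _ n] mult_carrier_mat[of _ n n _ n]
        unitary_cancel[OF assms] del: mat_diag_diag)
  then show ?thesis by (simp add: spectral_mat_def)
qed

lemma mat_log_spectral_mat:
  assumes "unitary n U" "\<And>i. i < n \<Longrightarrow> 0 < l i"
  shows "mat_log (spectral_mat n U l) = spectral_mat n U (\<lambda>i. ln (l i))"
  using mat_log_spectral[OF assms] by (simp add: spectral_mat_def)

lemma quadratic_form_spectral_mat:
  assumes U: "U \<in> carrier_mat n n" and v: "v \<in> carrier_vec n"
  shows "(spectral_mat n U f *\<^sub>v v) \<bullet>c v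
    = complex_of_real (\<Sum>k<n. f k * (cmod (\<Sum>i<n. cnj (U $$ (i, k)) * v $ i))\<^sup>2)"
proof -
  have "(spectral_mat n U f *\<^sub>v v) \<bullet>c v
      = (\<Sum>i<n. (\<Sum>j<n. (\<Sum>k<n. U $$ (i, k) * f k * cnj (U $$ (j, k))) * v $ j) * cnj (v $ i))"
    using spectral_mat_carrier[OF U, of f] v U
    by (simp add: scalar_prod_def atLeast0LessThan index_spectral_mat)
  also have "\<dots> = (\<Sum>i<n. \<Sum>j<n. \<Sum>k<n. f k * ((cnj (U $$ (j, k)) * v $ j) * cnj (cnj (U $$ (i, k)) * v $ i)))"
    by (simp add: sum_distrib_left sum_distrib_right mult_ac)
  also have "\<dots> = (\<Sum>i<n. \<Sum>k<n. \<Sum>j<n. f k * ((cnj (U $$ (j, k)) * v $ j) * cnj (cnj (U $$ (i, k)) * v $ i)))"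
    by (intro sum.cong refl sum.swap)
  also have "\<dots> = (\<Sum>k<n. \<Sum>i<n. \<Sum>j<n. f k * ((cnj (U $$ (j, k)) * v $ j) * cnj (cnj (U $$ (i, k)) * v $ i)))"
    by (rule sum.swap)
  also have "\<dots> = (\<Sum>k<n. f k * ((\<Sum>j<n. cnj (U $$ (j, k)) * v $ j) * cnj (\<Sum>i<n. cnj (U $$ (i, k)) * v $ i)))"
    by (simp add: sum_distrib_left sum_distrib_right del: complex_cnj_mult)
  also have "\<dots> = complex_of_real (\<Sum>k<n. f k * (cmod (\<Sum>i<n. cnj (U $$ (i, k)) * v $ i))\<^sup>2)"
    by (simp only: of_real_sum of_real_mult complex_norm_square)
  finally show ?thesis .
qed

section \<open>Unitary diagonalisation of Hermitian matrices\<close>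

lemma unitary_completion:
  assumes v: "v \<in> carrier_vec n" "v \<noteq> 0\<^sub>v n"
  obtains W c where "unitary n W" "col W 0 = c \<cdot>\<^sub>v v"
proof -
  interpret cof_vec_space n "TYPE(complex)" .
  let ?ws = "gram_schmidt n (basis_completion v)"
  \<comment> \<open>Gram-Schmidt keeps its first input and gives orthogonal vectors that are not
    normalised; rescaling them to unit length is where the factor \<open>c\<close> of the conclusion
    comes from.\<close>
  define w where "w i = (1 / complex_of_real (sqrt (Re (?ws ! i \<bullet>c ?ws ! i)))) \<cdot>\<^sub>v ?ws ! i" for i
  note b = basis_completion[OF v]
  have n: "n \<noteq> 0" using v by auto
  from gram_schmidt_result[OF b(2,4,5) refl]
  have ws: "set ?ws \<subseteq> carrier_vec n" "corthogonal ?ws" "length ?ws = n"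
    by (auto simp: b)
  have hd: "?ws ! 0 = v"
  proof -
    obtain bs where "basis_completion v = v # bs" by (simp add: basis_completion_def Let_def)
    then have "hd ?ws = v" using gram_schmidt_hd[OF v(1), of bs] by simp
    moreover have "?ws \<noteq> []" using n ws(3) by auto
    ultimately show ?thesis by (simp add: hd_conv_nth)
  qed
  have wsc: "?ws ! i \<in> carrier_vec n" if "i < n" for i
    using that ws by auto
  have inner: "w j \<bullet>c w i = (if i = j then 1 else 0)" if ij: "i < n" "j < n" for i j
  proof -
    have c: "?ws ! i \<in> carrier_vec n" "?ws ! j \<in> carrier_vec n" using ij wsc by auto
    have "(?ws ! j \<bullet>c ?ws ! i = 0) = (j \<noteq> i)"
      using corthogonalD[OF ws(2)] ij ws(3) by auto
    moreover have "0 < ?ws ! i \<bullet>c ?ws ! i" if "i = j"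
    proof -
      have "?ws ! i \<noteq> 0\<^sub>v n"
        using calculation c that by auto
      then show ?thesis using conjugate_square_greater_0_vec[OF c(1)] by simp
    qed
    then have "?ws ! i \<bullet>c ?ws ! i = complex_of_real (Re (?ws ! i \<bullet>c ?ws ! i))"
      "0 < Re (?ws ! i \<bullet>c ?ws ! i)" if "i = j"
      using that by (auto simp: less_complex_def complex_eq_iff)
    ultimately show ?thesis
      using c by (auto simp: w_def conjugate_smult_vec field_simps simp flip: of_real_mult)
  qed
  define W where "W = mat n n (\<lambda>(i, j). w j $ i)"
  have W: "W \<in> carrier_mat n n" by (simp add: W_def)
  have "mat_adjoint W * W = 1\<^sub>m n"
  proof (rule eq_matI)
    fix i j assume "i < dim_row (1\<^sub>m n)" "j < dim_col (1\<^sub>m n)"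
    then have ij: "i < n" "j < n" by auto
    then have "(mat_adjoint W * W) $$ (i, j) = w j \<bullet>c w i"
      using carrier_vecD[OF wsc] by (auto simp: W_def w_def scalar_prod_def mult.commute intro!: sum.cong)
    then show "(mat_adjoint W * W) $$ (i, j) = 1\<^sub>m n $$ (i, j)"
      using inner[OF ij] ij by simp
  qed (auto simp: W_def)
  then have "unitary n W" using W by (simp add: unitary_def)
  moreover have "col W 0 = (1 / complex_of_real (sqrt (Re (v \<bullet>c v)))) \<cdot>\<^sub>v v"
    using v n hd by (intro eq_vecI) (auto simp: W_def w_def)
  ultimately show thesis by (rule that)
qed

text \<open>Deflation: in an orthonormal basis that starts with an eigenvector, the first column
  vanishes below the diagonal, and Hermitian symmetry clears the first row as well. The remaining
  block is Hermitian of smaller size, and induction applies.\<close>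

theorem hermitian_spectral_decomposition:
  assumes "A \<in> carrier_mat n n" "hermitian A"
  obtains U l where "unitary n U" "A = spectral_mat n U l"
proof -
  have "\<exists>U l. unitary n U \<and> A = spectral_mat n U l"
    using assms
  proof (induction n arbitrary: A)
    case 0
    then have "A = spectral_mat 0 (1\<^sub>m 0) (\<lambda>_. 0)" "unitary 0 (1\<^sub>m 0)"
        by (auto simp: unitary_def)
    then show ?case by blast
  next
    case (Suc m)
    let ?n = "Suc m"
    note A = Suc.prems(1)
    obtain as where as: "char_poly A = (\<Prod>a\<leftarrow>as. [:- a, 1:])" "length as = ?n"
      using char_poly_factorized[OF A] by auto
    then obtain e where "eigenvalue A e"
      using eigenvalue_root_char_poly[OF A] by (cases as) auto
    then obtain v where v: "v \<in> carrier_vec ?n" "v \<noteq> 0\<^sub>v ?n" and ev: "A *\<^sub>v v = e \<cdot>\<^sub>v v"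
      using A by (auto simp: eigenvalue_def eigenvector_def)
    obtain W c where W: "unitary ?n W" and col: "col W 0 = c \<cdot>\<^sub>v v"
      by (rule unitary_completion[OF v])
    have cs: "W \<in> carrier_mat ?n ?n" "mat_adjoint W \<in> carrier_mat ?n ?n"
      using W by (auto simp: unitary_def mat_adjoint_carrier)
    define B where "B = mat_adjoint W * A * W"
    have B: "B \<in> carrier_mat ?n ?n"
      using cs A by (auto simp: B_def mult_carrier_mat[of _ ?n ?n _ ?n])
    note assoc = assoc_mult_mat[of _ ?n ?n _ ?n _ ?n] mult_carrier_mat[of _ ?n ?n _ ?n]
    have hB: "mat_adjoint B = B"
      using Suc.prems(2) cs A unfolding B_def hermitian_def
      by (simp add: mat_adjoint_mult[of _ ?n ?n _ ?n] assoc)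
    have B_cnj: "B $$ (i, j) = cnj (B $$ (j, i))" if "i < ?n" "j < ?n" for i j
      using arg_cong[OF hB, of "\<lambda>M. M $$ (i, j)"] that B by simp
    have "col (A * W) 0 = e \<cdot>\<^sub>v col W 0"
    proof -
      have "col (A * W) 0 = A *\<^sub>v col W 0" using A cs by (intro col_mult2) auto
      then show ?thesis using A v ev by (simp add: col mult_mat_vec smult_smult_assoc mult.commute)
    qed
    then have AW: "(A * W) $$ (i, 0) = e * W $$ (i, 0)" if "i < ?n" for i
    proof -
      have "(A * W) $$ (i, 0) = col (A * W) 0 $ i"
        by (rule index_col[symmetric]) (use that A cs in auto)
      then show ?thesis using \<open>col (A * W) 0 = _\<close> that cs by simp
    qed
    \<comment> \<open>Column 0 of \<open>A * W\<close> is \<open>e\<close> times column 0 of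
      \<open>W\<close>, so that of \<open>B\<close> is \<open>e\<close> times column 0 of
      \<open>mat_adjoint W * W\<close>, the identity.\<close>
    have B0: "B $$ (i, 0) = (if i = 0 then e else 0)" if i: "i < ?n" for i
    proof -
      have "B = mat_adjoint W * (A * W)"
        using cs A by (simp add: B_def assoc)
      then have "B $$ (i, 0) = (\<Sum>k<?n. mat_adjoint W $$ (i, k) * (A * W) $$ (k, 0))"
        using i cs A by (simp add: scalar_prod_def atLeast0LessThan)
      also have "\<dots> = e * (\<Sum>k<?n. mat_adjoint W $$ (i, k) * W $$ (k, 0))"
        using AW by (simp add: sum_distrib_left mult_ac del: sum.lessThan_Suc)
      also have "(\<Sum>k<?n. mat_adjoint W $$ (i, k) * W $$ (k, 0)) = (mat_adjoint W * W) $$ (i, 0)"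
        using i cs by (simp add: scalar_prod_def atLeast0LessThan)
      finally show ?thesis
        using i unitary_adjoint_mult[OF W] by simp
    qed
    have e: "e = complex_of_real (Re e)"
      using B_cnj[of 0 0] B0[of 0] by (simp add: complex_eq_iff)
    define A' where "A' = mat m m (\<lambda>(i, j). B $$ (Suc i, Suc j))"
    have "hermitian A'"
      unfolding hermitian_def by (rule eq_matI) (auto simp: A'_def B_cnj[symmetric])
    then obtain U' l where U': "unitary m U'" and A': "A' = spectral_mat m U' l"
      using Suc.IH[of A'] by (auto simp: A'_def)
    have U'c: "U' \<in> carrier_mat m m" using U' by (rule unitary_carrier)
    \<comment> \<open>\<open>U1\<close> is the block sum of 1 and \<open>U'\<close>; it diagonalises
      \<open>B\<close>, with \<open>e\<close> prepended to the eigenvalues \<open>l\<close>.\<close>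
    define U1 where "U1 = mat ?n ?n (\<lambda>(i, j). if i = 0 \<or> j = 0 then (if i = j then 1 else 0)
        else U' $$ (i - 1, j - 1))"
    have U1c: "U1 \<in> carrier_mat ?n ?n" by (simp add: U1_def)
    have U1i: "U1 $$ (0, 0) = 1" "i < m \<Longrightarrow> U1 $$ (Suc i, 0) = 0" "j < m \<Longrightarrow> U1 $$ (0, Suc j) = 0"
      "i < m \<Longrightarrow> j < m \<Longrightarrow> U1 $$ (Suc i, Suc j) = U' $$ (i, j)" for i j
      by (auto simp: U1_def)
    have U1: "unitary ?n U1"
      unfolding unitary_def
    proof (intro conjI U1c eq_matI)
      fix i j assume "i < dim_row (1\<^sub>m ?n)" "j < dim_col (1\<^sub>m ?n)"
      then have ij: "i < ?n" "j < ?n" by auto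
      have "(\<Sum>k<m. cnj (U' $$ (k, i')) * U' $$ (k, j')) = (if i' = j' then 1 else 0)"
        if "i' < m" "j' < m" for i' j'
        using arg_cong[OF unitary_adjoint_mult[OF U'], of "\<lambda>M. M $$ (i', j')"] that U'c
        by (simp add: scalar_prod_def atLeast0LessThan)
      then show "(mat_adjoint U1 * U1) $$ (i, j) = 1\<^sub>m ?n $$ (i, j)"
        using ij U1c
        by (cases i; cases j)
          (auto simp: scalar_prod_def atLeast0LessThan sum.lessThan_Suc_shift U1i
            simp del: sum.lessThan_Suc)
    qed (use U1c in auto)
    define l' where "l' = case_nat (Re e) l"
    have "B = spectral_mat ?n U1 l'"
    proof (rule eq_matI)
      fix i j assume "i < dim_row (spectral_mat ?n U1 l')" "j < dim_col (spectral_mat ?n U1 l')"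
      then have ij: "i < ?n" "j < ?n" using spectral_mat_carrier[OF U1c, of l'] by auto
      have "B $$ (Suc i', Suc j') = (\<Sum>k<m. U' $$ (i', k) * l k * cnj (U' $$ (j', k)))"
        if "i' < m" "j' < m" for i' j'
        using arg_cong[OF A', of "\<lambda>M. M $$ (i', j')"] that U'c
        by (simp add: index_spectral_mat A'_def)
      then show "B $$ (i, j) = spectral_mat ?n U1 l' $$ (i, j)"
        using ij U1c B0[of i] B0[of j] B_cnj[of 0 j] e
        by (cases i; cases j)
          (auto simp: index_spectral_mat sum.lessThan_Suc_shift U1i l'_def
            simp del: sum.lessThan_Suc)
    qed (use B spectral_mat_carrier[OF U1c, of l'] in auto)
    moreover have "A = W * B * mat_adjoint W"
      using cs A W by (simp add: B_def assoc unitary_cancel unitary_mult_adjoint)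
    ultimately have "A = spectral_mat ?n (W * U1) l'"
      using cs U1c mat_adjoint_carrier[OF U1c]
      by (simp add: spectral_mat_def assoc mat_adjoint_mult[of _ ?n ?n _ ?n])
    then show ?case using unitary_mult[OF W U1] by blast
  qed
  then show thesis using that by blast
qed

text \<open>Evaluating the form at column \<open>i\<close> of \<open>U\<close> isolates
  \<open>l i\<close>. Conversely, the form is a sum of squared moduli of the coordinates of
  \<open>v\<close> weighted by \<open>l\<close>, and a nonzero \<open>v\<close> has a nonzero
  coordinate because \<open>U\<close> is invertible.\<close>

lemma positive_definite_spectral_mat_iff:
  assumes "unitary n U"
  shows "positive_definite n (spectral_mat n U l) \<longleftrightarrow> (\<forall>i<n. 0 < l i)"
proof
  have U: "U \<in> carrier_mat n n" using assms by (rule unitary_carrier)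
  have coord: "(\<Sum>i<n. cnj (U $$ (i, k)) * v $ i) = (mat_adjoint U *\<^sub>v v) $ k"
    if "k < n" "v \<in> carrier_vec n" for k v
    using that U by (auto simp: scalar_prod_def atLeast0LessThan intro!: sum.cong)
  {
    assume pd: "positive_definite n (spectral_mat n U l)"
    show "\<forall>i<n. 0 < l i"
    proof (intro allI impI)
      fix i assume i: "i < n"
      have c: "mat_adjoint U *\<^sub>v col U i = unit_vec n i"
        using i U unitary_adjoint_mult[OF assms] col_mult2[of "mat_adjoint U" n n U n i]
        by (simp add: mat_adjoint_carrier)
      have cU: "col U i \<in> carrier_vec n" using U by (simp add: carrier_vecI)
      have "col U i \<noteq> 0\<^sub>v n"
      proof
        assume "col U i = 0\<^sub>v n"
        moreover have "mat_adjoint U *\<^sub>v 0\<^sub>v n = 0\<^sub>v n"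
          using U by (intro eq_vecI) (auto simp: scalar_prod_def)
        ultimately have "unit_vec n i = (0\<^sub>v n :: complex vec)"
          using c by simp
        then show False using i by (metis index_unit_vec(2) index_zero_vec(1) zero_neq_one)
      qed
      then have "0 < (spectral_mat n U l *\<^sub>v col U i) \<bullet>c col U i"
        using pd cU by (simp add: positive_definite_def)
      then have "0 < (\<Sum>k<n. l k * (cmod (unit_vec n i $ k))\<^sup>2)"
        using cU U by (simp add: quadratic_form_spectral_mat coord c less_complex_def)
      also have "\<dots> = l i"
        using i by (simp add: if_distrib[of cmod] if_distrib[of "\<lambda>x. x ^ 2"] if_distrib[of "(*) _"] cong: if_cong)
      finally show "0 < l i" .
    qed
  }
  {
    assume l: "\<forall>i<n. 0 < l i"
    show "positive_definite n (spectral_mat n U l)"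
      unfolding positive_definite_def
    proof (intro conjI ballI impI)
      fix v :: "complex vec" assume v: "v \<in> carrier_vec n" "v \<noteq> 0\<^sub>v n"
      have "\<exists>k<n. (mat_adjoint U *\<^sub>v v) $ k \<noteq> 0"
      proof (rule ccontr)
        assume "\<not> ?thesis"
        then have "mat_adjoint U *\<^sub>v v = 0\<^sub>v n" using U by (intro eq_vecI) auto
        then have "U *\<^sub>v (mat_adjoint U *\<^sub>v v) = 0\<^sub>v n"
          using U by (intro eq_vecI) (auto simp: scalar_prod_def)
        moreover have "U *\<^sub>v (mat_adjoint U *\<^sub>v v) = v"
          using U v assoc_mult_mat_vec[OF U mat_adjoint_carrier[OF U] v(1)]
          by (simp add: unitary_mult_adjoint[OF assms])
        ultimately show False using v by simp
      qed
      then obtain k where k: "k < n" "(mat_adjoint U *\<^sub>v v) $ k \<noteq> 0" by blast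
      have "0 < (\<Sum>k<n. l k * (cmod (\<Sum>i<n. cnj (U $$ (i, k)) * v $ i))\<^sup>2)"
        by (rule sum_pos2[of _ k]) (use l k v in \<open>auto simp: coord intro!: mult_nonneg_nonneg intro: less_imp_le\<close>)
      then show "0 < (spectral_mat n U l *\<^sub>v v) \<bullet>c v"
        using quadratic_form_spectral_mat[OF U v(1)] by (simp add: less_complex_def)
    qed (use U in \<open>auto simp: hermitian_spectral_mat\<close>)
  }
qed

lemma positive_definite_decomposition:
  assumes "positive_definite n A"
  obtains U l where "unitary n U" "\<And>i. i < n \<Longrightarrow> 0 < l i" "A = spectral_mat n U l"
  using assms hermitian_spectral_decomposition[of A n] positive_definite_spectral_mat_iff
  by (metis positive_definite_def)

section \<open>Relative entropy\<close>

text \<open>For two orthonormal bases these squared inner products form a doubly stochastic matrix.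
  It is all that the trace of a product of functions of two non-commuting operators retains of their
  eigenvectors.\<close>

definition overlap :: "complex mat \<Rightarrow> complex mat \<Rightarrow> nat \<Rightarrow> nat \<Rightarrow> real" where
  "overlap U W i j = (cmod ((mat_adjoint U * W) $$ (i, j)))\<^sup>2"

lemma overlap_nonneg [simp]: "0 \<le> overlap U W i j"
  by (simp add: overlap_def)

lemma unitary_mat_adjoint: "unitary n U \<Longrightarrow> unitary n (mat_adjoint U)"
  using unitary_mult_adjoint[of n U] unfolding unitary_def
  by (simp add: mat_adjoint_carrier)

lemma unitary_sum_row:
  assumes "unitary n Z" "i < n"
  shows "(\<Sum>j<n. (cmod (Z $$ (i, j)))\<^sup>2) = 1"
proof -
  have Z: "Z \<in> carrier_mat n n" using assms(1) by (rule unitary_carrier)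
  have "complex_of_real (\<Sum>j<n. (cmod (Z $$ (i, j)))\<^sup>2) = (\<Sum>j<n. Z $$ (i, j) * cnj (Z $$ (i, j)))"
    by (simp only: of_real_sum complex_norm_square)
  also have "\<dots> = (Z * mat_adjoint Z) $$ (i, i)"
    using Z assms(2) by (simp add: scalar_prod_def atLeast0LessThan)
  also have "\<dots> = 1" using assms by (simp add: unitary_mult_adjoint)
  finally show ?thesis by (simp only: of_real_eq_1_iff)
qed

lemma overlap_sum_right:
  assumes "unitary n U" "unitary n W" "i < n"
  shows "(\<Sum>j<n. overlap U W i j) = 1"
  using unitary_sum_row[OF unitary_mult[OF unitary_mat_adjoint[OF assms(1)] assms(2)] assms(3)]
  by (simp add: overlap_def)

lemma overlap_commute:
  assumes "unitary n U" "unitary n W" "i < n" "j < n"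
  shows "overlap U W i j = overlap W U j i"
proof -
  have c: "U \<in> carrier_mat n n" "W \<in> carrier_mat n n"
    using assms by (auto simp: unitary_def)
  have "mat_adjoint (mat_adjoint U * W) = mat_adjoint W * U"
    using c mat_adjoint_carrier[OF c(1)] by (simp add: mat_adjoint_mult[of _ n n _ n])
  then have "(mat_adjoint W * U) $$ (j, i) = cnj ((mat_adjoint U * W) $$ (i, j))"
    using c assms index_mat_adjoint[of j "mat_adjoint U * W" i] by simp
  then show ?thesis by (simp add: overlap_def)
qed

lemma overlap_sum_left:
  assumes "unitary n U" "unitary n W" "j < n"
  shows "(\<Sum>i<n. overlap U W i j) = 1"
  using overlap_sum_right[OF assms(2,1,3)] overlap_commute[OF assms(1,2) _ assms(3)] by simp

text \<open>Conjugating by \<open>U\<close> leaves two diagonal matrices intertwined by the unitary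
  \<open>mat_adjoint U * W\<close>, whose entries enter only through their squared moduli.\<close>

lemma mat_trace_spectral_mat_mult:
  assumes U: "unitary n U" and W: "unitary n W"
  shows "mat_trace (spectral_mat n U f * spectral_mat n W g)
    = complex_of_real (\<Sum>i<n. \<Sum>j<n. overlap U W i j * f i * g j)"
proof -
  let ?F = "mat_diag n (\<lambda>i. complex_of_real (f i))" and ?G = "mat_diag n (\<lambda>i. complex_of_real (g i))"
  let ?Z = "mat_adjoint U * W"
  have c: "U \<in> carrier_mat n n" "mat_adjoint U \<in> carrier_mat n n" "W \<in> carrier_mat n n"
      "mat_adjoint W \<in> carrier_mat n n" "?F \<in> carrier_mat n n" "?G \<in> carrier_mat n n"
    using U W by (auto simp: unitary_def mat_adjoint_carrier)
  have Z: "?Z \<in> carrier_mat n n" using c by (auto simp: mult_carrier_mat[of _ n n _ n])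
  have Z': "mat_adjoint ?Z = mat_adjoint W * U"
    using c by (simp add: mat_adjoint_mult[of _ n n _ n])
  have "spectral_mat n U f * spectral_mat n W g
      = U * ((?F * ?Z) * (?G * mat_adjoint ?Z)) * mat_adjoint U"
    unfolding Z' spectral_mat_def using c
    by (simp add: assoc_mult_mat[of _ n n _ n _ n] mult_carrier_mat[of _ n n _ n]
        unitary_mult_adjoint[OF U])
  then have "mat_trace (spectral_mat n U f * spectral_mat n W g)
      = mat_trace ((?F * ?Z) * (?G * mat_adjoint ?Z))"
    using c Z mat_adjoint_carrier[OF Z]
    by (simp add: mat_trace_conjugate[OF U] mult_carrier_mat[of _ n n _ n])
  also have "\<dots> = (\<Sum>i<n. \<Sum>j<n. (?F * ?Z) $$ (i, j) * (?G * mat_adjoint ?Z) $$ (j, i))"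
    by (rule mat_trace_mult) (use c Z mat_adjoint_carrier[OF Z] in \<open>auto simp: mult_carrier_mat[of _ n n _ n]\<close>)
  also have "\<dots> = (\<Sum>i<n. \<Sum>j<n. complex_of_real (f i) * complex_of_real (g j) * (?Z $$ (i, j) * cnj (?Z $$ (i, j))))"
    using Z by (simp add: mat_diag_mult_left[OF Z] mat_diag_mult_left[OF mat_adjoint_carrier[OF Z]] mult_ac
        del: index_mult_mat)
  also have "\<dots> = complex_of_real (\<Sum>i<n. \<Sum>j<n. overlap U W i j * f i * g j)"
    by (simp only: of_real_sum of_real_mult overlap_def complex_norm_square mult_ac)
  finally show ?thesis .
qed

definition rel_entropy :: "complex mat \<Rightarrow> complex mat \<Rightarrow> real" where
  "rel_entropy \<rho> \<sigma> = Re (mat_trace (\<rho> * mat_log \<rho>)) - Re (mat_trace (\<rho> * mat_log \<sigma>))"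

text \<open>The ratios \<open>q j / p i\<close> are the eigenvalues of the relative modular
  operator, left multiplication by the second operator times the inverse of right multiplication by
  the first. Only a classical weighted sum of their logarithms remains.\<close>

lemma rel_entropy_spectral_mat:
  assumes U: "unitary n U" and W: "unitary n W"
    and p: "\<And>i. i < n \<Longrightarrow> 0 < p i" and q: "\<And>i. i < n \<Longrightarrow> 0 < q i"
  shows "rel_entropy (spectral_mat n U p) (spectral_mat n W q)
    = - (\<Sum>(i, j)\<in>{..<n} \<times> {..<n}. overlap U W i j * p i * ln (q j / p i))"
proof -
  have "Re (mat_trace (spectral_mat n U p * mat_log (spectral_mat n U p)))
      = (\<Sum>i<n. p i * ln (p i))"
    using U p by (simp add: mat_log_spectral_mat spectral_mat_mult mat_trace_spectral_mat)
  \<comment> \<open>Row sums equal to one spread the single sum over the index set of the cross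
    term.\<close>
  also have "\<dots> = (\<Sum>i<n. (\<Sum>j<n. overlap U W i j) * (p i * ln (p i)))"
    using overlap_sum_right[OF U W] by simp
  also have "\<dots> = (\<Sum>i<n. \<Sum>j<n. overlap U W i j * p i * ln (p i))"
    by (simp add: sum_distrib_right mult.assoc)
  finally have "rel_entropy (spectral_mat n U p) (spectral_mat n W q)
      = (\<Sum>i<n. \<Sum>j<n. overlap U W i j * p i * (ln (p i) - ln (q j)))"
    using W q by (simp add: rel_entropy_def mat_log_spectral_mat mat_trace_spectral_mat_mult[OF U W]
        right_diff_distrib sum_subtractf)
  also have "\<dots> = (\<Sum>i<n. \<Sum>j<n. - (overlap U W i j * p i * ln (q j / p i)))"
    using p q by (intro sum.cong refl) (simp add: ln_divide_pos algebra_simps)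
  finally show ?thesis
    by (simp add: sum_negf sum.cartesian_product)
qed

text \<open>The entry \<open>y $$ (j, i)\<close> is the coefficient of the rank-one operator made of
  column \<open>j\<close> of \<open>W\<close> and column \<open>i\<close> of \<open>U\<close>. These
  operators are joint eigenvectors of the left and right multiplications involved, so both quadratic
  forms are diagonal in \<open>y\<close>.\<close>

lemma mat_trace_resolvent_forms:
  assumes U: "unitary n U" and W: "unitary n W" and y: "y \<in> carrier_mat n n"
  defines "Y \<equiv> W * y * mat_adjoint U"
  shows "mat_trace (mat_adjoint Y * spectral_mat n U p)
      = (\<Sum>i<n. \<Sum>j<n. cnj (y $$ (j, i)) * cnj ((mat_adjoint U * W) $$ (i, j)) * p i)"
    and "mat_trace (spectral_mat n W q * (Y * mat_adjoint Y))
      = complex_of_real (\<Sum>i<n. \<Sum>j<n. q j * (cmod (y $$ (j, i)))\<^sup>2)"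
    and "mat_trace (spectral_mat n U p * (mat_adjoint Y * Y))
      = complex_of_real (\<Sum>i<n. \<Sum>j<n. p i * (cmod (y $$ (j, i)))\<^sup>2)"
proof -
  let ?P = "mat_diag n (\<lambda>i. complex_of_real (p i))" and ?Q = "mat_diag n (\<lambda>i. complex_of_real (q i))"
  let ?Z = "mat_adjoint U * W" and ?y' = "mat_adjoint y"
  have c: "U \<in> carrier_mat n n" "mat_adjoint U \<in> carrier_mat n n" "W \<in> carrier_mat n n"
      "mat_adjoint W \<in> carrier_mat n n" "?P \<in> carrier_mat n n" "?Q \<in> carrier_mat n n"
      "y \<in> carrier_mat n n" "?y' \<in> carrier_mat n n"
    using U W y by (auto simp: unitary_def mat_adjoint_carrier)
  note cs = assoc_mult_mat[of _ n n _ n _ n] mult_carrier_mat[of _ n n _ n]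
  have Z: "?Z \<in> carrier_mat n n" using c by (auto simp: cs)
  have Z': "mat_adjoint ?Z = mat_adjoint W * U"
    using c by (simp add: mat_adjoint_mult[of _ n n _ n])
  have Y': "mat_adjoint Y = U * ?y' * mat_adjoint W"
    unfolding Y_def using c by (simp add: mat_adjoint_mult[of _ n n _ n] cs)
  have "mat_adjoint Y * spectral_mat n U p = U * (?y' * (mat_adjoint ?Z * ?P)) * mat_adjoint U"
    unfolding Y' Z' spectral_mat_def using c by (simp add: cs)
  then have "mat_trace (mat_adjoint Y * spectral_mat n U p) = mat_trace (?y' * (mat_adjoint ?Z * ?P))"
    using c mat_adjoint_carrier[OF Z] by (simp add: mat_trace_conjugate[OF U] cs(2))
  also have "\<dots> = (\<Sum>i<n. \<Sum>j<n. ?y' $$ (i, j) * (mat_adjoint ?Z * ?P) $$ (j, i))"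
    by (rule mat_trace_mult) (use c mat_adjoint_carrier[OF Z] in \<open>auto simp: cs\<close>)
  also have "\<dots> = (\<Sum>i<n. \<Sum>j<n. cnj (y $$ (j, i)) * cnj (?Z $$ (i, j)) * p i)"
    using Z y by (simp add: mat_diag_mult_right[OF mat_adjoint_carrier[OF Z]] mult_ac del: index_mult_mat)
  finally show "mat_trace (mat_adjoint Y * spectral_mat n U p)
      = (\<Sum>i<n. \<Sum>j<n. cnj (y $$ (j, i)) * cnj (?Z $$ (i, j)) * p i)" .
  have "spectral_mat n W q * (Y * mat_adjoint Y) = W * ((?Q * y) * ?y') * mat_adjoint W"
    unfolding Y' spectral_mat_def unfolding Y_def using c by (simp add: cs unitary_cancel[OF U] unitary_cancel[OF W])
  then have "mat_trace (spectral_mat n W q * (Y * mat_adjoint Y)) = mat_trace ((?Q * y) * ?y')"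
    using c by (simp only: mat_trace_conjugate[OF W] mult_carrier_mat[of _ n n _ n])
  also have "\<dots> = (\<Sum>j<n. \<Sum>i<n. (?Q * y) $$ (j, i) * ?y' $$ (i, j))"
    by (rule mat_trace_mult) (use c in \<open>auto simp: cs\<close>)
  also have "\<dots> = (\<Sum>j<n. \<Sum>i<n. complex_of_real (q j) * (y $$ (j, i) * cnj (y $$ (j, i))))"
    using y by (simp add: mat_diag_mult_left[OF y] mult.assoc del: index_mult_mat)
  also have "\<dots> = (\<Sum>i<n. \<Sum>j<n. complex_of_real (q j) * (y $$ (j, i) * cnj (y $$ (j, i))))"
    by (rule sum.swap)
  also have "\<dots> = complex_of_real (\<Sum>i<n. \<Sum>j<n. q j * (cmod (y $$ (j, i)))\<^sup>2)"
    by (simp only: of_real_sum of_real_mult complex_norm_square)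
  finally show "mat_trace (spectral_mat n W q * (Y * mat_adjoint Y))
      = complex_of_real (\<Sum>i<n. \<Sum>j<n. q j * (cmod (y $$ (j, i)))\<^sup>2)" .
  have "spectral_mat n U p * (mat_adjoint Y * Y) = U * ((?P * ?y') * y) * mat_adjoint U"
    unfolding Y' spectral_mat_def unfolding Y_def using c by (simp add: cs unitary_cancel[OF U] unitary_cancel[OF W])
  then have "mat_trace (spectral_mat n U p * (mat_adjoint Y * Y)) = mat_trace ((?P * ?y') * y)"
    using c by (simp only: mat_trace_conjugate[OF U] mult_carrier_mat[of _ n n _ n])
  also have "\<dots> = (\<Sum>i<n. \<Sum>j<n. (?P * ?y') $$ (i, j) * y $$ (j, i))"
    by (rule mat_trace_mult) (use c in \<open>auto simp: cs\<close>)
  also have "\<dots> = (\<Sum>i<n. \<Sum>j<n. complex_of_real (p i) * (y $$ (j, i) * cnj (y $$ (j, i))))"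
    using y by (simp add: mat_diag_mult_left[OF c(8)] mult_ac del: index_mult_mat)
  also have "\<dots> = complex_of_real (\<Sum>i<n. \<Sum>j<n. p i * (cmod (y $$ (j, i)))\<^sup>2)"
    by (simp only: of_real_sum of_real_mult complex_norm_square)
  finally show "mat_trace (spectral_mat n U p * (mat_adjoint Y * Y))
      = complex_of_real (\<Sum>i<n. \<Sum>j<n. p i * (cmod (y $$ (j, i)))\<^sup>2)" .
qed

text \<open>For spectral decompositions of \<open>\<rho>\<close> and \<open>\<sigma>\<close>, the number \<open>resolvent_form\<close> is the value
  \<open>\<langle>\<rho>, (L\<^sub>\<sigma> + t R\<^sub>\<rho>)\<^sup>-\<^sup>1 \<rho>\<rangle>\<close>, where \<open>L\<^sub>\<sigma>\<close> and \<open>R\<^sub>\<rho>\<close> are left and right multiplication, and it is the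
  maximum of \<open>resolvent_functional\<close>. The latter makes sense without diagonalisation.\<close>

definition resolvent_form ::
  "nat \<Rightarrow> complex mat \<Rightarrow> (nat \<Rightarrow> real) \<Rightarrow> complex mat \<Rightarrow> (nat \<Rightarrow> real) \<Rightarrow> real \<Rightarrow> real" where
  "resolvent_form n U p W q t =
     (\<Sum>(i, j)\<in>{..<n} \<times> {..<n}. overlap U W i j * p i / (q j / p i + t))"

definition resolvent_functional ::
  "complex mat \<Rightarrow> complex mat \<Rightarrow> real \<Rightarrow> complex mat \<Rightarrow> real" where
  "resolvent_functional \<rho> \<sigma> t Y = 2 * Re (mat_trace (mat_adjoint Y * \<rho>))
     - Re (mat_trace (\<sigma> * (Y * mat_adjoint Y))) - t * Re (mat_trace (\<rho> * (mat_adjoint Y * Y)))"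

text \<open>In these coordinates the functional decouples into one scalar quadratic for each pair
  \<open>(i, j)\<close>, so it can be maximised entrywise.\<close>

lemma resolvent_functional_spectral_mat:
  assumes "unitary n U" "unitary n W" "y \<in> carrier_mat n n"
  shows "resolvent_functional (spectral_mat n U p) (spectral_mat n W q) t (W * y * mat_adjoint U)
    = (\<Sum>(i, j)\<in>{..<n} \<times> {..<n}. 2 * p i * Re (y $$ (j, i) * (mat_adjoint U * W) $$ (i, j))
        - (q j + t * p i) * (cmod (y $$ (j, i)))\<^sup>2)"
proof -
  have "resolvent_functional (spectral_mat n U p) (spectral_mat n W q) t (W * y * mat_adjoint U)
    = 2 * (\<Sum>i<n. \<Sum>j<n. Re (cnj (y $$ (j, i)) * cnj ((mat_adjoint U * W) $$ (i, j)) * p i))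
      - (\<Sum>i<n. \<Sum>j<n. q j * (cmod (y $$ (j, i)))\<^sup>2)
      - t * (\<Sum>i<n. \<Sum>j<n. p i * (cmod (y $$ (j, i)))\<^sup>2)"
    unfolding resolvent_functional_def mat_trace_resolvent_forms[OF assms]
    by (simp only: Re_sum Re_complex_of_real)
  also have "\<dots> = (\<Sum>i<n. \<Sum>j<n. 2 * Re (cnj (y $$ (j, i)) * cnj ((mat_adjoint U * W) $$ (i, j)) * p i)
      - q j * (cmod (y $$ (j, i)))\<^sup>2 - t * (p i * (cmod (y $$ (j, i)))\<^sup>2))"
    by (simp only: sum_distrib_left sum_subtractf)
  also have "\<dots> = (\<Sum>i<n. \<Sum>j<n. 2 * p i * Re (y $$ (j, i) * (mat_adjoint U * W) $$ (i, j))
        - (q j + t * p i) * (cmod (y $$ (j, i)))\<^sup>2)"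
    by (intro sum.cong refl) (simp add: algebra_simps del: index_mult_mat)
  finally show ?thesis by (simp add: sum.cartesian_product)
qed

lemma resolvent_functional_le:
  assumes U: "unitary n U" and W: "unitary n W" and Y: "Y \<in> carrier_mat n n" and t: "0 \<le> t"
    and p: "\<And>i. i < n \<Longrightarrow> 0 < p i" and q: "\<And>i. i < n \<Longrightarrow> 0 < q i"
  shows "resolvent_functional (spectral_mat n U p) (spectral_mat n W q) t Y
    \<le> resolvent_form n U p W q t"
proof -
  have c: "U \<in> carrier_mat n n" "mat_adjoint U \<in> carrier_mat n n" "W \<in> carrier_mat n n"
      "mat_adjoint W \<in> carrier_mat n n"
    using U W by (auto simp: unitary_def mat_adjoint_carrier)
  define y where "y = mat_adjoint W * Y * U"
  have y: "y \<in> carrier_mat n n"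
    using c Y by (auto simp: y_def mult_carrier_mat[of _ n n _ n])
  have Yy: "Y = W * y * mat_adjoint U"
    using c Y by (simp add: y_def assoc_mult_mat[of _ n n _ n _ n] mult_carrier_mat[of _ n n _ n]
        unitary_cancel[OF W] unitary_mult_adjoint[OF U])
  show ?thesis
    unfolding Yy resolvent_functional_spectral_mat[OF U W y] resolvent_form_def
  proof (rule sum_mono, clarify)
    fix i j assume ij: "i < n" "j < n"
    let ?z = "(mat_adjoint U * W) $$ (i, j)" and ?y = "y $$ (j, i)" and ?a = "q j + t * p i"
    have a: "0 < ?a" using p[OF ij(1)] q[OF ij(2)] t by (simp add: add_pos_nonneg)
    have "2 * p i * Re (?y * ?z) \<le> 2 * p i * (cmod ?y * cmod ?z)"
      using p[OF ij(1)] complex_Re_le_cmod[of "?y * ?z"] by (simp add: norm_mult del: index_mult_mat)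
    \<comment> \<open>Completing the square in the modulus of \<open>?y\<close>: over real r, the
      maximum of \<open>2 p |z| r - a r^2\<close> is \<open>p^2 |z|^2 / a\<close>.\<close>
    moreover have "0 \<le> (?a * cmod ?y - p i * cmod ?z)\<^sup>2 / ?a"
      using a by simp
    moreover have "(?a * cmod ?y - p i * cmod ?z)\<^sup>2 / ?a
        = ?a * (cmod ?y)\<^sup>2 - 2 * p i * (cmod ?y * cmod ?z) + (cmod ?z)\<^sup>2 * (p i)\<^sup>2 / ?a"
      using a by (simp add: power2_eq_square field_simps del: index_mult_mat)
    moreover have "overlap U W i j * p i / (q j / p i + t) = (cmod ?z)\<^sup>2 * (p i)\<^sup>2 / ?a"
      using p[OF ij(1)] a by (simp add: overlap_def power2_eq_square field_simps del: index_mult_mat)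
    ultimately show "2 * p i * Re (?y * ?z) - ?a * (cmod ?y)\<^sup>2
        \<le> overlap U W i j * p i / (q j / p i + t)"
      by linarith
  qed
qed

lemma resolvent_functional_attained:
  assumes U: "unitary n U" and W: "unitary n W" and t: "0 \<le> t"
    and p: "\<And>i. i < n \<Longrightarrow> 0 < p i" and q: "\<And>i. i < n \<Longrightarrow> 0 < q i"
  obtains Y where "Y \<in> carrier_mat n n"
    "resolvent_functional (spectral_mat n U p) (spectral_mat n W q) t Y = resolvent_form n U p W q t"
proof -
  have c: "U \<in> carrier_mat n n" "mat_adjoint U \<in> carrier_mat n n" "W \<in> carrier_mat n n"
    using U W by (auto simp: unitary_def mat_adjoint_carrier)
  \<comment> \<open>The stationary point of each scalar quadratic; the conjugate makes its product
    with the entry of \<open>mat_adjoint U * W\<close> real and nonnegative, as equality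
    requires.\<close>
  define y where "y = mat n n (\<lambda>(j, i). cnj ((mat_adjoint U * W) $$ (i, j)) * p i / (q j + t * p i))"
  have y: "y \<in> carrier_mat n n" by (simp add: y_def)
  let ?Y = "W * y * mat_adjoint U"
  have "resolvent_functional (spectral_mat n U p) (spectral_mat n W q) t ?Y
    = resolvent_form n U p W q t"
    unfolding resolvent_functional_spectral_mat[OF U W y] resolvent_form_def
  proof (rule sum.cong[OF refl], clarify)
    fix i j assume ij: "i < n" "j < n"
    let ?z = "(mat_adjoint U * W) $$ (i, j)" and ?y = "y $$ (j, i)" and ?a = "q j + t * p i"
    have a: "0 < ?a" using p[OF ij(1)] q[OF ij(2)] t by (simp add: add_pos_nonneg)
    have yy: "?y = cnj ?z * complex_of_real (p i / ?a)"
      using ij by (simp add: y_def del: index_mult_mat)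
    have "?y * ?z = complex_of_real (p i / ?a * (cmod ?z)\<^sup>2)"
      unfolding yy by (simp only: of_real_mult complex_norm_square mult_ac)
    then have 1: "Re (?y * ?z) = p i / ?a * (cmod ?z)\<^sup>2"
      by (simp only: Re_complex_of_real)
    have 2: "(cmod ?y)\<^sup>2 = (p i / ?a)\<^sup>2 * (cmod ?z)\<^sup>2"
      unfolding yy norm_mult norm_of_real by (simp add: power_mult_distrib power_divide del: index_mult_mat)
    have 3: "overlap U W i j * p i / (q j / p i + t) = (cmod ?z)\<^sup>2 * (p i)\<^sup>2 / ?a"
      using p[OF ij(1)] a by (simp add: overlap_def power2_eq_square field_simps del: index_mult_mat)
    show "2 * p i * Re (?y * ?z) - ?a * (cmod ?y)\<^sup>2 = overlap U W i j * p i / (q j / p i + t)"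
      unfolding 1 2 3 using a by (simp add: power2_eq_square del: index_mult_mat)
  qed
  moreover have "?Y \<in> carrier_mat n n" using c y by (auto simp: mult_carrier_mat[of _ n n _ n])
  ultimately show thesis using that by blast
qed

text \<open>The difference of the two sums of logarithms, shifted by \<open>t\<close>, is nondecreasing in \<open>t\<close> and
  tends to zero at infinity.\<close>

lemma sum_ln_le_of_resolvents:
  fixes a r :: "'a \<Rightarrow> real" and b s :: "'b \<Rightarrow> real"
  assumes fin: "finite I" "finite J"
    and r: "\<And>i. i \<in> I \<Longrightarrow> 0 < r i" and s: "\<And>j. j \<in> J \<Longrightarrow> 0 < s j"
    and total: "sum a I = sum b J"
    and le: "\<And>t. 0 \<le> t \<Longrightarrow> (\<Sum>j\<in>J. b j / (s j + t)) \<le> (\<Sum>i\<in>I. a i / (r i + t))"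
  shows "(\<Sum>i\<in>I. a i * ln (r i)) \<le> (\<Sum>j\<in>J. b j * ln (s j))"
proof -
  define g where "g t = (\<Sum>i\<in>I. a i * ln (r i + t)) - (\<Sum>j\<in>J. b j * ln (s j + t))" for t
  have der: "(g has_real_derivative (\<Sum>i\<in>I. a i / (r i + t)) - (\<Sum>j\<in>J. b j / (s j + t))) (at t)"
    if "0 \<le> t" for t
    unfolding g_def
    by (intro DERIV_diff DERIV_sum) (use that r s in \<open>auto intro!: derivative_eq_intros add_pos_nonneg\<close>)
  have mono: "g 0 \<le> g t" if "0 \<le> t" for t
    by (rule DERIV_nonneg_imp_nondecreasing[OF that]) (use der le in force)
  \<comment> \<open>The two families have the same total weight, so the terms in \<open>ln t\<close>
    cancel, and what remains has a limit as \<open>t\<close> grows.\<close>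
  have eq: "g t = (\<Sum>i\<in>I. a i * ln (1 + r i / t)) - (\<Sum>j\<in>J. b j * ln (1 + s j / t))" if t: "0 < t" for t
  proof -
    have shift: "x * ln (y + t) = x * ln (1 + y / t) + x * ln t" if "0 < y" for x y
    proof -
      have "y + t = (1 + y / t) * t" using t by (simp add: field_simps)
      moreover have "0 < 1 + y / t" using t that by (simp add: add_pos_pos)
      ultimately have "ln (y + t) = ln (1 + y / t) + ln t"
        using t by (metis ln_mult_pos)
      then show ?thesis by (simp add: distrib_left)
    qed
    have "(\<Sum>i\<in>I. a i * ln (r i + t)) = (\<Sum>i\<in>I. a i * ln (1 + r i / t)) + sum a I * ln t"
      by (simp add: shift r sum.distrib sum_distrib_right)
    moreover have "(\<Sum>j\<in>J. b j * ln (s j + t)) = (\<Sum>j\<in>J. b j * ln (1 + s j / t)) + sum b J * ln t"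
      by (simp add: shift s sum.distrib sum_distrib_right)
    ultimately show ?thesis by (simp add: g_def total)
  qed
  have lim: "((\<lambda>t. ln (1 + y / t)) \<longlongrightarrow> ln (1 + 0)) at_top" for y :: real
    by (intro tendsto_ln tendsto_add tendsto_const tendsto_divide_0[OF tendsto_const]
        filterlim_at_top_imp_at_infinity filterlim_ident) simp
  have "((\<lambda>t. (\<Sum>i\<in>I. a i * ln (1 + r i / t)) - (\<Sum>j\<in>J. b j * ln (1 + s j / t)))
      \<longlongrightarrow> (\<Sum>i\<in>I. a i * ln (1 + 0)) - (\<Sum>j\<in>J. b j * ln (1 + 0))) at_top"
    by (intro tendsto_diff tendsto_sum tendsto_mult tendsto_const lim)
  then have "((\<lambda>t. (\<Sum>i\<in>I. a i * ln (1 + r i / t)) - (\<Sum>j\<in>J. b j * ln (1 + s j / t))) \<longlongrightarrow> 0) at_top"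
    by simp
  moreover have "eventually (\<lambda>t. (\<Sum>i\<in>I. a i * ln (1 + r i / t)) - (\<Sum>j\<in>J. b j * ln (1 + s j / t)) = g t) at_top"
    using eventually_gt_at_top[of 0] by eventually_elim (simp add: eq)
  ultimately have "(g \<longlongrightarrow> 0) at_top"
    by (rule Lim_transform_eventually)
  moreover have "eventually (\<lambda>t. g 0 \<le> g t) at_top"
    using eventually_ge_at_top[of 0] by eventually_elim (rule mono)
  ultimately have "g 0 \<le> 0"
    by (rule tendsto_lowerbound) simp
  then show ?thesis by (simp add: g_def)
qed

text \<open>Besides equal traces, \<open>test\<close> is the only link between the two pairs: every
  value of the functional on the small space is also a value on the large one. The maxima are
  therefore ordered for each \<open>t\<close>, which is the input for comparing the
  logarithms.\<close>

theorem rel_entropy_mono: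
  assumes pd: "positive_definite n \<rho>" "positive_definite n \<sigma>"
      "positive_definite m \<rho>'" "positive_definite m \<sigma>'"
    and tr: "mat_trace \<rho> = mat_trace \<rho>'"
    and test: "\<And>t X. X \<in> carrier_mat m m \<Longrightarrow> \<exists>Y \<in> carrier_mat n n.
      resolvent_functional \<rho> \<sigma> t Y = resolvent_functional \<rho>' \<sigma>' t X"
  shows "rel_entropy \<rho>' \<sigma>' \<le> rel_entropy \<rho> \<sigma>"
proof -
  obtain U p where U: "unitary n U" and p: "\<And>i. i < n \<Longrightarrow> 0 < p i" and \<rho>: "\<rho> = spectral_mat n U p"
    using positive_definite_decomposition[OF pd(1)] by metis
  obtain W q where W: "unitary n W" and q: "\<And>i. i < n \<Longrightarrow> 0 < q i" and \<sigma>: "\<sigma> = spectral_mat n W q"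
    using positive_definite_decomposition[OF pd(2)] by metis
  obtain U' p' where U': "unitary m U'" and p': "\<And>i. i < m \<Longrightarrow> 0 < p' i"
      and \<rho>': "\<rho>' = spectral_mat m U' p'"
    using positive_definite_decomposition[OF pd(3)] by metis
  obtain W' q' where W': "unitary m W'" and q': "\<And>i. i < m \<Longrightarrow> 0 < q' i"
      and \<sigma>': "\<sigma>' = spectral_mat m W' q'"
    using positive_definite_decomposition[OF pd(4)] by metis
  \<comment> \<open>Row sums equal to one reduce the total weight to the trace, which the two sides
    share.\<close>
  have total: "(\<Sum>(i, j)\<in>{..<k} \<times> {..<k}. overlap A B i j * f i) = (\<Sum>i<k. f i)"
    if "unitary k A" "unitary k B" for k A B f
  proof -
    have "(\<Sum>i<k. \<Sum>j<k. overlap A B i j * f i) = (\<Sum>i<k. (\<Sum>j<k. overlap A B i j) * f i)"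
      by (simp add: sum_distrib_right)
    then show ?thesis
      using overlap_sum_right[OF that] by (simp add: sum.cartesian_product[symmetric])
  qed
  let ?I = "{..<n} \<times> {..<n}" and ?J = "{..<m} \<times> {..<m}"
  have "(\<Sum>x\<in>?I. overlap U W (fst x) (snd x) * p (fst x) * ln (q (snd x) / p (fst x)))
      \<le> (\<Sum>x\<in>?J. overlap U' W' (fst x) (snd x) * p' (fst x) * ln (q' (snd x) / p' (fst x)))"
  proof (rule sum_ln_le_of_resolvents)
    have "(\<Sum>i<n. p i) = (\<Sum>i<m. p' i)"
      using tr unfolding \<rho> \<rho>' mat_trace_spectral_mat[OF U] mat_trace_spectral_mat[OF U']
      by (simp only: of_real_eq_iff)
    then show "(\<Sum>x\<in>?I. overlap U W (fst x) (snd x) * p (fst x))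
        = (\<Sum>x\<in>?J. overlap U' W' (fst x) (snd x) * p' (fst x))"
      using total[OF U W] total[OF U' W'] by (simp add: case_prod_unfold)
  next
    fix t :: real assume t: "0 \<le> t"
    \<comment> \<open>An optimal test operator of the small pair is transported; it need not be
      optimal for the large pair, hence an inequality.\<close>
    obtain X where X: "X \<in> carrier_mat m m"
        and eq: "resolvent_functional \<rho>' \<sigma>' t X = resolvent_form m U' p' W' q' t"
      unfolding \<rho>' \<sigma>' by (rule resolvent_functional_attained[OF U' W' t p' q'])
    obtain Y where Y: "Y \<in> carrier_mat n n"
        "resolvent_functional \<rho> \<sigma> t Y = resolvent_functional \<rho>' \<sigma>' t X"
      using test[OF X] by blast
    then have "resolvent_form m U' p' W' q' t \<le> resolvent_form n U p W q t"
      using resolvent_functional_le[OF U W Y(1) t, of p q] p q eq unfolding \<rho> \<sigma> by simp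
    then show "(\<Sum>x\<in>?J. overlap U' W' (fst x) (snd x) * p' (fst x) / (q' (snd x) / p' (fst x) + t))
        \<le> (\<Sum>x\<in>?I. overlap U W (fst x) (snd x) * p (fst x) / (q (snd x) / p (fst x) + t))"
      by (simp add: resolvent_form_def case_prod_unfold)
  qed (use p q p' q' in auto)
  then show ?thesis
    using rel_entropy_spectral_mat[OF U W, of p q] rel_entropy_spectral_mat[OF U' W', of p' q'] p q p' q'
    unfolding \<rho> \<sigma> \<rho>' \<sigma>' by (simp add: case_prod_unfold)
qed

section \<open>Configurations, embeddings and marginals\<close>

lemma finite_cfg [simp]: "finite A \<Longrightarrow> finite (cfg d A)"
  by (auto simp: cfg_def intro: finite_PiE)

lemma label_in_cfg: "finite A \<Longrightarrow> i < hdim d A \<Longrightarrow> label d A i \<in> cfg d A"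
  using bij_betw_from_nat_into_finite[OF finite_cfg, of A d]
  by (auto simp: label_def hdim_def bij_betw_def)

lemma index_less_hdim: "finite A \<Longrightarrow> x \<in> cfg d A \<Longrightarrow> index d A x < hdim d A"
  using to_nat_on_finite[OF finite_cfg, of A d]
  by (auto simp: index_def hdim_def bij_betw_def)

lemma label_index [simp]: "finite A \<Longrightarrow> x \<in> cfg d A \<Longrightarrow> label d A (index d A x) = x"
  by (simp add: label_def index_def countable_finite)

lemma index_label [simp]: "finite A \<Longrightarrow> i < hdim d A \<Longrightarrow> index d A (label d A i) = i"
  using to_nat_on_finite[OF finite_cfg, of A d]
  by (auto simp: label_def index_def hdim_def bij_betw_def intro!: to_nat_on_from_nat_into)

lemma sum_index:
  "finite A \<Longrightarrow> (\<Sum>i<hdim d A. g i) = (\<Sum>x\<in>cfg d A. g (index d A x))"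
  using sum.reindex_bij_betw[OF to_nat_on_finite[OF finite_cfg, of A d], of g]
  by (simp add: index_def hdim_def)

lemma restrict_in_cfg [simp]: "x \<in> cfg d B \<Longrightarrow> A \<subseteq> B \<Longrightarrow> restrict x A \<in> cfg d A"
  by (auto simp: cfg_def)

lemma override_in_cfg [simp]:
  "u \<in> cfg d A \<Longrightarrow> z \<in> cfg d (B - A) \<Longrightarrow> A \<subseteq> B \<Longrightarrow> override_on z u A \<in> cfg d B"
  by (auto simp: cfg_def PiE_iff override_on_def extensional_def)

lemma override_in_cfg' [simp]:
  "u \<in> cfg d A \<Longrightarrow> z \<in> cfg d B \<Longrightarrow> A \<subseteq> B \<Longrightarrow> override_on z u A \<in> cfg d B"
  by (auto simp: cfg_def PiE_iff override_on_def extensional_def)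

lemma restrict_override_on [simp]: "u \<in> cfg d A \<Longrightarrow> restrict (override_on z u A) A = u"
  by (auto simp: cfg_def PiE_iff override_on_def extensional_def fun_eq_iff)

lemma override_on_override_on [simp]: "override_on (override_on z x A) u A = override_on z u A"
  by (auto simp: override_on_def fun_eq_iff)

text \<open>A configuration on \<open>B\<close> is a pair of configurations on \<open>A\<close> and
  on \<open>B - A\<close>: the index form of factoring the tensor product.\<close>

lemma sum_cfg_split:
  assumes "A \<subseteq> B"
  shows "(\<Sum>x\<in>cfg d B. g x) = (\<Sum>y\<in>cfg d A. \<Sum>z\<in>cfg d (B - A). g (override_on z y A))"
proof -
  have "(\<Sum>x\<in>cfg d B. g x) = (\<Sum>(y, z)\<in>cfg d A \<times> cfg d (B - A). g (override_on z y A))"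
  proof (rule sum.reindex_bij_witness[of _ "\<lambda>(y, z). override_on z y A" "\<lambda>x. (restrict x A, restrict x (B - A))"])
    fix x assume x: "x \<in> cfg d B"
    show eq: "(case (restrict x A, restrict x (B - A)) of (y, z) \<Rightarrow> override_on z y A) = x"
      using x assms by (auto simp: cfg_def PiE_iff override_on_def extensional_def fun_eq_iff)
    show "(case (restrict x A, restrict x (B - A)) of (y, z) \<Rightarrow> g (override_on z y A)) = g x"
      using eq by simp
    show "(restrict x A, restrict x (B - A)) \<in> cfg d A \<times> cfg d (B - A)"
      using x assms by auto
  next
    fix w assume w: "w \<in> cfg d A \<times> cfg d (B - A)"
    obtain y z where yz: "w = (y, z)" by (cases w)
    with w have y: "y \<in> cfg d A" and z: "z \<in> cfg d (B - A)" by auto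
    have "restrict (override_on z y A) (B - A) = z"
      using z by (auto simp: cfg_def PiE_iff override_on_def extensional_def fun_eq_iff)
    then show "(restrict (case w of (y, z) \<Rightarrow> override_on z y A) A,
        restrict (case w of (y, z) \<Rightarrow> override_on z y A) (B - A)) = w"
      using y yz by simp
    show "(case w of (y, z) \<Rightarrow> override_on z y A) \<in> cfg d B"
      using y z yz assms by simp
  qed
  then show ?thesis by (simp add: sum.cartesian_product)
qed

text \<open>The condition is the Kronecker delta of the identity factor in \<open>embed\<close>; it
  cuts the sum down to one fibre. The last hypothesis is phrased so that \<open>z\<close> may be a
  configuration on all of \<open>B\<close> or only on \<open>B - A\<close>; both occur.\<close>

lemma sum_cfg_fiber:
  assumes "finite B" "A \<subseteq> B" and z: "\<And>u. u \<in> cfg d A \<Longrightarrow> override_on z u A \<in> cfg d B"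
  shows "(\<Sum>y\<in>cfg d B. if \<forall>v\<in>B - A. z v = y v then g y else 0)
    = (\<Sum>u\<in>cfg d A. g (override_on z u A))"
proof -
  have "(\<Sum>y\<in>cfg d B. if \<forall>v\<in>B - A. z v = y v then g y else 0)
      = (\<Sum>y\<in>{y \<in> cfg d B. \<forall>v\<in>B - A. z v = y v}. g y)"
    using assms(1) by (simp add: sum.inter_filter)
  also have "\<dots> = (\<Sum>u\<in>cfg d A. g (override_on z u A))"
  proof (rule sum.reindex_bij_witness[of _ "\<lambda>u. override_on z u A" "\<lambda>y. restrict y A"])
    fix y assume "y \<in> {y \<in> cfg d B. \<forall>v\<in>B - A. z v = y v}"
    then have y: "y \<in> cfg d B" and "\<forall>v\<in>B - A. z v = y v" by auto
    moreover have "override_on z (restrict y A) A \<in> cfg d B"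
      using y by (intro z restrict_in_cfg[OF _ assms(2)])
    ultimately show "override_on z (restrict y A) A = y"
      using assms(2) by (fastforce simp: cfg_def PiE_iff extensional_def override_on_def fun_eq_iff)
    then show "g (override_on z (restrict y A) A) = g y" by simp
    show "restrict y A \<in> cfg d A" using y assms(2) by (rule restrict_in_cfg)
  next
    fix u assume u: "u \<in> cfg d A"
    show "restrict (override_on z u A) A = u" using u by simp
    show "override_on z u A \<in> {y \<in> cfg d B. \<forall>v\<in>B - A. z v = y v}" using z[OF u] by simp
  qed
  finally show ?thesis .
qed

text \<open>Addressing entries by configurations keeps the arbitrary enumeration of the product
  basis out of calculations with tensor factors.\<close>

definition entry :: "('v \<Rightarrow> nat) \<Rightarrow> 'v set \<Rightarrow> complex mat \<Rightarrow> ('v \<Rightarrow> nat) \<Rightarrow> ('v \<Rightarrow> nat) \<Rightarrow> complex" where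
  "entry d A M x y = M $$ (index d A x, index d A y)"

abbreviation op_on :: "('v \<Rightarrow> nat) \<Rightarrow> 'v set \<Rightarrow> complex mat set" where
  "op_on d A \<equiv> carrier_mat (hdim d A) (hdim d A)"

lemma entry_eqI:
  assumes "finite A" "M \<in> op_on d A" "N \<in> op_on d A"
    and "\<And>x y. x \<in> cfg d A \<Longrightarrow> y \<in> cfg d A \<Longrightarrow> entry d A M x y = entry d A N x y"
  shows "M = N"
proof (rule eq_matI)
  fix i j assume "i < dim_row N" "j < dim_col N"
  then have ij: "i < hdim d A" "j < hdim d A" using assms by auto
  then show "M $$ (i, j) = N $$ (i, j)"
    using assms(4)[OF label_in_cfg[OF assms(1) ij(1)] label_in_cfg[OF assms(1) ij(2)]] assms(1)
    by (simp add: entry_def)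
qed (use assms in auto)

lemma entry_mult:
  assumes "finite A" "M \<in> op_on d A" "N \<in> op_on d A" "x \<in> cfg d A" "y \<in> cfg d A"
  shows "entry d A (M * N) x y = (\<Sum>z\<in>cfg d A. entry d A M x z * entry d A N z y)"
  using assms index_less_hdim[OF assms(1)]
  by (simp add: entry_def scalar_prod_def atLeast0LessThan sum_index)

lemma entry_adjoint:
  assumes "finite A" "M \<in> op_on d A" "x \<in> cfg d A" "y \<in> cfg d A"
  shows "entry d A (mat_adjoint M) x y = cnj (entry d A M y x)"
  using assms index_less_hdim[OF assms(1)] by (simp add: entry_def)

lemma index_eq_iff:
  "finite A \<Longrightarrow> x \<in> cfg d A \<Longrightarrow> y \<in> cfg d A \<Longrightarrow> index d A x = index d A y \<longleftrightarrow> x = y"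
  by (metis label_index)

lemma mat_trace_entry:
  assumes "finite A" "M \<in> op_on d A"
  shows "mat_trace M = (\<Sum>x\<in>cfg d A. entry d A M x x)"
  using assms by (simp add: mat_trace_def entry_def sum_index)

lemma mat_trace_mult_entry:
  assumes "finite A" "M \<in> op_on d A" "N \<in> op_on d A"
  shows "mat_trace (M * N) = (\<Sum>x\<in>cfg d A. \<Sum>y\<in>cfg d A. entry d A M x y * entry d A N y x)"
  using assms by (simp add: mat_trace_mult[of _ "hdim d A" "hdim d A"] entry_def sum_index)

lemma embed_carrier [simp]: "embed d B A M \<in> op_on d B"
  by (simp add: embed_def)

lemma marginal_carrier [simp]: "marginal d V \<rho> A \<in> op_on d A"
  by (simp add: marginal_def)

lemma dim_embed [simp]: "dim_row (embed d B A M) = hdim d B" "dim_col (embed d B A M) = hdim d B"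
  by (simp_all add: embed_def)

lemma dim_marginal [simp]:
  "dim_row (marginal d V \<rho> A) = hdim d A" "dim_col (marginal d V \<rho> A) = hdim d A"
  by (simp_all add: marginal_def)

lemma entry_embed:
  assumes "finite B" "x \<in> cfg d B" "y \<in> cfg d B"
  shows "entry d B (embed d B A M) x y =
    (if \<forall>v\<in>B - A. x v = y v then entry d A M (restrict x A) (restrict y A) else 0)"
  using assms index_less_hdim[OF assms(1)] by (simp add: entry_def embed_def)

lemma entry_marginal:
  assumes "finite A" "x \<in> cfg d A" "y \<in> cfg d A"
  shows "entry d A (marginal d V \<rho> A) x y =
    (\<Sum>z\<in>cfg d (V - A). entry d V \<rho> (override_on z x A) (override_on z y A))"
  using assms index_less_hdim[OF assms(1)] by (simp add: entry_def marginal_def)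

text \<open>The deltas of the two factors let an intermediate configuration differ from
  \<open>x\<close> only inside \<open>A\<close>, and the sum over such configurations is the matrix
  product on \<open>A\<close>.\<close>

lemma embed_mult:
  assumes B: "finite B" "A \<subseteq> B" and M: "M \<in> op_on d A" "N \<in> op_on d A"
  shows "embed d B A (M * N) = embed d B A M * embed d B A N"
proof (rule entry_eqI[OF B(1)])
  have A: "finite A" using B finite_subset by blast
  fix x y assume x: "x \<in> cfg d B" and y: "y \<in> cfg d B"
  have "entry d B (embed d B A M * embed d B A N) x y
      = (\<Sum>z\<in>cfg d B. if \<forall>v\<in>B - A. x v = z v then
           entry d A M (restrict x A) (restrict z A) * entry d B (embed d B A N) z y else 0)"
    by (auto simp: entry_mult B(1) x y entry_embed intro!: sum.cong)
  also have "\<dots> = (\<Sum>u\<in>cfg d A. entry d A M (restrict x A) u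
      * entry d B (embed d B A N) (override_on x u A) y)"
    by (subst sum_cfg_fiber[OF B]) (use x B in auto)
  also have "\<dots> = (if \<forall>v\<in>B - A. x v = y v then
      \<Sum>u\<in>cfg d A. entry d A M (restrict x A) u * entry d A N u (restrict y A) else 0)"
  proof -
    have "(\<forall>v\<in>B - A. override_on x u A v = y v) \<longleftrightarrow> (\<forall>v\<in>B - A. x v = y v)" for u
      by (auto simp: override_on_def)
    moreover have "entry d B (embed d B A N) (override_on x u A) y
        = (if \<forall>v\<in>B - A. override_on x u A v = y v then entry d A N u (restrict y A) else 0)"
      if "u \<in> cfg d A" for u
      using that x y B by (simp add: entry_embed)
    ultimately show ?thesis
      by (cases "\<forall>v\<in>B - A. x v = y v") (simp_all del: ball_simps)
  qed
  also have "\<dots> = entry d B (embed d B A (M * N)) x y"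
    using x y B A M by (simp add: entry_embed entry_mult)
  finally show "entry d B (embed d B A (M * N)) x y = entry d B (embed d B A M * embed d B A N) x y"
    by simp
qed (auto intro!: mult_carrier_mat)

lemma embed_adjoint:
  assumes B: "finite B" "A \<subseteq> B" and M: "M \<in> op_on d A"
  shows "embed d B A (mat_adjoint M) = mat_adjoint (embed d B A M)"
proof (rule entry_eqI[OF B(1)])
  have A: "finite A" using B finite_subset by blast
  fix x y assume "x \<in> cfg d B" "y \<in> cfg d B"
  then show "entry d B (embed d B A (mat_adjoint M)) x y
      = entry d B (mat_adjoint (embed d B A M)) x y"
    using A B M by (auto simp: entry_embed entry_adjoint)
qed (auto simp: mat_adjoint_carrier)

text \<open>The eigenvalues are pulled back along restriction of configurations to \<open>A\<close>;
  this is how logarithms are carried through \<open>embed\<close>.\<close>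

lemma embed_mat_diag:
  assumes B: "finite B" "A \<subseteq> B"
  shows "embed d B A (mat_diag (hdim d A) f)
    = mat_diag (hdim d B) (\<lambda>i. f (index d A (restrict (label d B i) A)))"
proof (rule entry_eqI[OF B(1)])
  have A: "finite A" using B finite_subset by blast
  fix x y assume x: "x \<in> cfg d B" and y: "y \<in> cfg d B"
  have "x = y \<longleftrightarrow> (\<forall>v\<in>B - A. x v = y v) \<and> restrict x A = restrict y A"
    using x y B(2) unfolding cfg_def PiE_iff extensional_def fun_eq_iff restrict_def
    by (metis (mono_tags, lifting) DiffI mem_Collect_eq)
  moreover have "entry d C (mat_diag (hdim d C) g) u v = (if u = v then g (index d C u) else 0)"
    if "finite C" "u \<in> cfg d C" "v \<in> cfg d C" for C g u v
    using that index_less_hdim[OF that(1)] by (simp add: entry_def mat_diag_def index_eq_iff)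
  ultimately show "entry d B (embed d B A (mat_diag (hdim d A) f)) x y
      = entry d B (mat_diag (hdim d B) (\<lambda>i. f (index d A (restrict (label d B i) A)))) x y"
    using x y A B by (simp add: entry_embed)
qed auto

text \<open>The duality that characterises the partial trace: the delta in \<open>embed\<close>
  forces two configurations to agree off \<open>A\<close>, and summing over the common part produces
  the marginal.\<close>

lemma mat_trace_mult_embed:
  assumes B: "finite B" "A \<subseteq> B" and \<rho>: "\<rho> \<in> op_on d B" and M: "M \<in> op_on d A"
  shows "mat_trace (\<rho> * embed d B A M) = mat_trace (marginal d B \<rho> A * M)"
proof -
  have A: "finite A" using B finite_subset by blast
  have "mat_trace (\<rho> * embed d B A M) = (\<Sum>x\<in>cfg d B. \<Sum>y\<in>cfg d B.
      if \<forall>v\<in>B - A. x v = y v then entry d B \<rho> x y * entry d A M (restrict y A) (restrict x A) else 0)"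
    using \<rho> B by (auto simp: mat_trace_mult_entry entry_embed intro!: sum.cong)
  also have "\<dots> = (\<Sum>x\<in>cfg d B. \<Sum>u\<in>cfg d A. entry d B \<rho> x (override_on x u A) * entry d A M u (restrict x A))"
  proof (rule sum.cong[OF refl])
    fix x assume x: "x \<in> cfg d B"
    show "(\<Sum>y\<in>cfg d B. if \<forall>v\<in>B - A. x v = y v
        then entry d B \<rho> x y * entry d A M (restrict y A) (restrict x A) else 0)
      = (\<Sum>u\<in>cfg d A. entry d B \<rho> x (override_on x u A) * entry d A M u (restrict x A))"
      by (subst sum_cfg_fiber[OF B]) (use x B in auto)
  qed
  also have "\<dots> = (\<Sum>x\<in>cfg d A. \<Sum>z\<in>cfg d (B - A). \<Sum>u\<in>cfg d A.
      entry d B \<rho> (override_on z x A) (override_on z u A) * entry d A M u x)"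
    by (subst sum_cfg_split[OF B(2)]) simp
  also have "\<dots> = (\<Sum>x\<in>cfg d A. \<Sum>u\<in>cfg d A. \<Sum>z\<in>cfg d (B - A).
      entry d B \<rho> (override_on z x A) (override_on z u A) * entry d A M u x)"
    by (intro sum.cong refl sum.swap)
  also have "\<dots> = mat_trace (marginal d B \<rho> A * M)"
    using A M by (simp add: mat_trace_mult_entry[of A _ d] entry_marginal sum_distrib_right)
  finally show ?thesis .
qed

lemma marginal_marginal:
  assumes V: "finite V" "B \<subseteq> V" "A \<subseteq> B"
  shows "marginal d B (marginal d V \<rho> B) A = marginal d V \<rho> (A :: 'v set)"
proof (rule entry_eqI[of A])
  have fin: "finite B" using V finite_subset by blast
  then show A: "finite A" using V finite_subset by blast
  fix x y assume x: "x \<in> cfg d A" and y: "y \<in> cfg d A"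
  have sets: "V - A - (B - A) = V - B" "B - A \<subseteq> V - A" using V by auto
  have ov: "override_on (override_on z' z (B - A)) u A = override_on z' (override_on z u A) B" for z' z u :: "'v \<Rightarrow> nat"
    using V by (auto simp: override_on_def fun_eq_iff)
  show "entry d A (marginal d B (marginal d V \<rho> B) A) x y = entry d A (marginal d V \<rho> A) x y"
    using x y A fin V
    by (simp add: entry_marginal sum_cfg_split[OF sets(2)] sets(1) ov)
qed auto

lemma marginal_self:
  assumes "finite V" "\<rho> \<in> op_on d V"
  shows "marginal d V \<rho> V = \<rho>"
proof (rule entry_eqI[OF assms(1)])
  fix x y assume x: "x \<in> cfg d V" and y: "y \<in> cfg d V"
  have "cfg d {} = {\<lambda>_. undefined}" by (simp add: cfg_def)
  moreover have "override_on (\<lambda>_. undefined) u V = u" if "u \<in> cfg d V" for u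
    using that by (auto simp: cfg_def PiE_iff override_on_def extensional_def fun_eq_iff)
  ultimately show "entry d V (marginal d V \<rho> V) x y = entry d V \<rho> x y"
    using x y assms by (simp add: entry_marginal)
qed (use assms in auto)

text \<open>Tracing out \<open>Q - P\<close> touches only the factor \<open>N\<close>, while the
  identity on \<open>P - Q\<close> survives. Strong subadditivity uses this to compute the marginal
  of its reference operator.\<close>

lemma marginal_embed:
  assumes fin: "finite P" "finite Q"
  shows "marginal d (P \<union> Q) (embed d (P \<union> Q) Q N) P = embed d P (P \<inter> Q) (marginal d Q N (P \<inter> Q))"
proof (rule entry_eqI[OF fin(1)])
  fix x y assume x: "x \<in> cfg d P" and y: "y \<in> cfg d P"
  have sets: "P \<union> Q - P = Q - P \<inter> Q" by auto
  have cond: "(\<forall>v\<in>P \<union> Q - Q. override_on z x P v = override_on z y P v) \<longleftrightarrow> (\<forall>v\<in>P - P \<inter> Q. x v = y v)" for z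
    by (auto simp: override_on_def)
  have res: "restrict (override_on z u P) Q = override_on z (restrict u (P \<inter> Q)) (P \<inter> Q)"
    if "z \<in> cfg d (Q - P \<inter> Q)" for z u
    using that by (auto simp: cfg_def PiE_iff override_on_def extensional_def fun_eq_iff)
  have cf: "override_on z u P \<in> cfg d (P \<union> Q)" if "z \<in> cfg d (Q - P \<inter> Q)" "u \<in> cfg d P" for z u
    using that override_in_cfg[of u d P z "P \<union> Q"] by (simp add: sets)
  show "entry d P (marginal d (P \<union> Q) (embed d (P \<union> Q) Q N) P) x y
      = entry d P (embed d P (P \<inter> Q) (marginal d Q N (P \<inter> Q))) x y"
    using x y fin
    by (cases "\<forall>v\<in>P - P \<inter> Q. x v = y v") (simp_all add: entry_marginal entry_embed sets cf cond res del: ball_simps)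
qed auto

lemma mat_trace_marginal:
  assumes "finite V" "A \<subseteq> V" "\<rho> \<in> op_on d V"
  shows "mat_trace (marginal d V \<rho> A) = mat_trace \<rho>"
proof -
  have "finite A" using assms finite_subset by blast
  then show ?thesis
    using assms by (simp add: mat_trace_entry[of A _ d] mat_trace_entry[of V _ d] entry_marginal
        sum_cfg_split[OF assms(2)])
qed

lemma hermitian_marginal:
  assumes V: "finite V" "A \<subseteq> V" and \<rho>: "\<rho> \<in> op_on d V" "hermitian \<rho>"
  shows "hermitian (marginal d V \<rho> A)"
  unfolding hermitian_def
proof (rule entry_eqI[of A])
  show A: "finite A" using V finite_subset by blast
  fix x y assume x: "x \<in> cfg d A" and y: "y \<in> cfg d A"
  have "cnj (entry d V \<rho> u v) = entry d V \<rho> v u" if "u \<in> cfg d V" "v \<in> cfg d V" for u v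
    using entry_adjoint[OF V(1) \<rho>(1) that(2,1)] \<rho>(2) by (simp add: hermitian_def)
  then show "entry d A (mat_adjoint (marginal d V \<rho> A)) x y = entry d A (marginal d V \<rho> A) x y"
    using x y A V by (simp add: entry_adjoint entry_marginal)
qed (auto simp: mat_adjoint_carrier)

lemma quadratic_form_entry:
  assumes "finite A" "M \<in> op_on d A" "v \<in> carrier_vec (hdim d A)"
  shows "(M *\<^sub>v v) \<bullet>c v = (\<Sum>x\<in>cfg d A. \<Sum>y\<in>cfg d A.
    entry d A M x y * v $ index d A y * cnj (v $ index d A x))"
  using assms index_less_hdim[OF assms(1)]
  by (simp add: scalar_prod_def atLeast0LessThan sum_index entry_def sum_distrib_right)

text \<open>The form of the marginal at \<open>v\<close> is the sum, over configurations
  \<open>z\<close> of the traced-out part, of the form of \<rho> at \<open>w z\<close>, the tensor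
  product of \<open>v\<close> with the basis vector of \<open>z\<close>. Each term is positive, and
  \<open>ne\<close> provides at least one.\<close>

lemma positive_definite_marginal:
  assumes V: "finite V" "A \<subseteq> V" and \<rho>: "positive_definite (hdim d V) \<rho>" and ne: "cfg d V \<noteq> {}"
  shows "positive_definite (hdim d A) (marginal d V \<rho> A)"
  unfolding positive_definite_def
proof (intro conjI ballI impI)
  have A: "finite A" using V finite_subset by blast
  have \<rho>c: "\<rho> \<in> op_on d V" "hermitian \<rho>" using \<rho> by (auto simp: positive_definite_def)
  show "hermitian (marginal d V \<rho> A)" by (rule hermitian_marginal[OF V \<rho>c])
  fix v :: "complex vec" assume v: "v \<in> carrier_vec (hdim d A)" "v \<noteq> 0\<^sub>v (hdim d A)"
  define w where "w z = vec (hdim d V) (\<lambda>i. if \<forall>u\<in>V - A. z u = label d V i u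
    then v $ index d A (restrict (label d V i) A) else 0)" for z
  have wc: "w z \<in> carrier_vec (hdim d V)" for z by (simp add: w_def)
  have wi: "w z $ index d V x = (if \<forall>u\<in>V - A. z u = x u then v $ index d A (restrict x A) else 0)"
    if "x \<in> cfg d V" for x z
    using that V index_less_hdim[OF V(1)] by (simp add: w_def)
  have quad: "(\<rho> *\<^sub>v w z) \<bullet>c w z = (\<Sum>x\<in>cfg d A. \<Sum>y\<in>cfg d A.
      entry d V \<rho> (override_on z x A) (override_on z y A) * v $ index d A y * cnj (v $ index d A x))"
    if z: "z \<in> cfg d (V - A)" for z
  proof -
    have "(\<rho> *\<^sub>v w z) \<bullet>c w z = (\<Sum>x\<in>cfg d V. if \<forall>u\<in>V - A. z u = x u then
        (\<Sum>y\<in>cfg d V. if \<forall>u\<in>V - A. z u = y u then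
          entry d V \<rho> x y * v $ index d A (restrict y A) * cnj (v $ index d A (restrict x A)) else 0) else 0)"
      using V \<rho>c wc by (auto simp: quadratic_form_entry wi intro!: sum.cong)
    also have "\<dots> = (\<Sum>x\<in>cfg d A. \<Sum>y\<in>cfg d A.
      entry d V \<rho> (override_on z x A) (override_on z y A) * v $ index d A y * cnj (v $ index d A x))"
      using z V by (simp add: sum_cfg_fiber)
    finally show ?thesis .
  qed
  have eq: "(marginal d V \<rho> A *\<^sub>v v) \<bullet>c v = (\<Sum>z\<in>cfg d (V - A). (\<rho> *\<^sub>v w z) \<bullet>c w z)"
  proof -
    have "(marginal d V \<rho> A *\<^sub>v v) \<bullet>c v = (\<Sum>x\<in>cfg d A. \<Sum>y\<in>cfg d A. \<Sum>z\<in>cfg d (V - A).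
        entry d V \<rho> (override_on z x A) (override_on z y A) * v $ index d A y * cnj (v $ index d A x))"
      using A v by (simp add: quadratic_form_entry[of A _ d] entry_marginal sum_distrib_right)
    also have "\<dots> = (\<Sum>x\<in>cfg d A. \<Sum>z\<in>cfg d (V - A). \<Sum>y\<in>cfg d A.
        entry d V \<rho> (override_on z x A) (override_on z y A) * v $ index d A y * cnj (v $ index d A x))"
      by (intro sum.cong refl sum.swap)
    also have "\<dots> = (\<Sum>z\<in>cfg d (V - A). \<Sum>x\<in>cfg d A. \<Sum>y\<in>cfg d A.
        entry d V \<rho> (override_on z x A) (override_on z y A) * v $ index d A y * cnj (v $ index d A x))"
      by (rule sum.swap)
    finally show ?thesis by (simp add: quad)
  qed
  have pos: "0 < (\<rho> *\<^sub>v w z) \<bullet>c w z" if z: "z \<in> cfg d (V - A)" for z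
  proof -
    obtain i where i: "i < hdim d A" "v $ i \<noteq> 0"
      using v by (metis carrier_vecD eq_vecI index_zero_vec)
    let ?x = "override_on z (label d A i) A"
    have x: "?x \<in> cfg d V" "label d A i \<in> cfg d A"
      using z V label_in_cfg[OF A i(1)] by auto
    have "w z $ index d V ?x = v $ i"
      unfolding wi[OF x(1)] using A i x by (simp add: override_on_def restrict_override_on[unfolded override_on_def])
    then have "w z \<noteq> 0\<^sub>v (hdim d V)"
      using i index_less_hdim[OF V(1) x(1)] by auto
    then show ?thesis using \<rho> wc by (simp add: positive_definite_def)
  qed
  obtain x where "x \<in> cfg d V" using ne by blast
  then have "restrict x (V - A) \<in> cfg d (V - A)" by simp
  then have "(\<Sum>z\<in>cfg d (V - A). 0) < (\<Sum>z\<in>cfg d (V - A). (\<rho> *\<^sub>v w z) \<bullet>c w z)"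
    using V pos by (intro sum_strict_mono) auto
  then show "0 < (marginal d V \<rho> A *\<^sub>v v) \<bullet>c v"
    by (simp add: eq)
qed simp

lemma marginal_in_states:
  assumes "finite V" "A \<subseteq> V" "\<rho> \<in> states d V"
  shows "marginal d V \<rho> A \<in> states d A"
proof -
  have \<rho>: "\<rho> \<in> op_on d V" "mat_trace \<rho> = 1"
    using assms(3) by (auto simp: states_def positive_definite_def)
  \<comment> \<open>An empty index set would make the trace zero instead of one.\<close>
  have "cfg d V \<noteq> {}"
    using mat_trace_entry[OF assms(1) \<rho>(1)] \<rho>(2) by auto
  then show ?thesis
    using assms(3) positive_definite_marginal[OF assms(1,2)] mat_trace_marginal[OF assms(1,2) \<rho>(1)]
    by (simp add: states_def)
qed

section \<open>Functional calculus and test operators under embedding\<close>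

lemma embed_unitary:
  assumes B: "finite B" "A \<subseteq> B" and U: "unitary (hdim d A) U"
  shows "unitary (hdim d B) (embed d B A U)"
proof -
  have c: "U \<in> op_on d A" "mat_adjoint U \<in> op_on d A"
    using U by (auto simp: unitary_def mat_adjoint_carrier)
  have "mat_adjoint (embed d B A U) * embed d B A U = embed d B A (mat_adjoint U * U)"
    using B c by (simp add: embed_adjoint embed_mult)
  also have "\<dots> = embed d B A (mat_diag (hdim d A) (\<lambda>_. 1))"
    using U by (simp add: unitary_adjoint_mult)
  also have "\<dots> = 1\<^sub>m (hdim d B)"
    unfolding embed_mat_diag[OF B] by simp
  finally show ?thesis by (simp add: unitary_def)
qed

lemma embed_spectral_mat:
  assumes B: "finite B" "A \<subseteq> B" and U: "U \<in> op_on d A"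
  shows "embed d B A (spectral_mat (hdim d A) U f)
    = spectral_mat (hdim d B) (embed d B A U) (\<lambda>i. f (index d A (restrict (label d B i) A)))"
  using B U mat_adjoint_carrier[OF U]
  by (simp add: spectral_mat_def embed_mult embed_adjoint embed_mat_diag mult_carrier_mat[of _ "hdim d A" "hdim d A"])

text \<open>A unitary that diagonalises \<open>M\<close> embeds to one that diagonalises the
  embedded operator, whose eigenvalues are all eigenvalues of \<open>M\<close>; both claims are read
  off from them.\<close>

lemma
  assumes B: "finite B" "A \<subseteq> B" and M: "positive_definite (hdim d A) M"
  shows positive_definite_embed: "positive_definite (hdim d B) (embed d B A M)"
    and mat_log_embed: "mat_log (embed d B A M) = embed d B A (mat_log M)"
proof -
  obtain U l where U: "unitary (hdim d A) U" and l: "\<And>i. i < hdim d A \<Longrightarrow> 0 < l i"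
      and M: "M = spectral_mat (hdim d A) U l"
    using positive_definite_decomposition[OF M] by metis
  have A: "finite A" using B finite_subset by blast
  have pos: "0 < l (index d A (restrict (label d B i) A))" if "i < hdim d B" for i
    using that B by (intro l index_less_hdim A restrict_in_cfg[OF label_in_cfg])
  show "positive_definite (hdim d B) (embed d B A M)"
    unfolding M embed_spectral_mat[OF B unitary_carrier[OF U]]
    using pos by (simp add: positive_definite_spectral_mat_iff[OF embed_unitary[OF B U]])
  show "mat_log (embed d B A M) = embed d B A (mat_log M)"
    unfolding M embed_spectral_mat[OF B unitary_carrier[OF U]]
    using mat_log_spectral_mat[OF embed_unitary[OF B U] pos] mat_log_spectral_mat[OF U l]
    by (simp add: embed_spectral_mat[OF B unitary_carrier[OF U]])
qed

text \<open>Since \<open>embed\<close> respects products and adjoints, each of the three traces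
  pairs \<rho> or \<sigma> with an embedded operator, and such a pairing reads only the
  marginal.\<close>

lemma resolvent_functional_embed:
  assumes B: "finite B" "A \<subseteq> B" and \<rho>: "\<rho> \<in> op_on d B" and \<sigma>: "\<sigma> \<in> op_on d B" and X: "X \<in> op_on d A"
  shows "resolvent_functional \<rho> \<sigma> t (embed d B A X)
    = resolvent_functional (marginal d B \<rho> A) (marginal d B \<sigma> A) t X"
proof -
  let ?n = "hdim d B" and ?m = "hdim d A"
  have X': "mat_adjoint X \<in> op_on d A" using X by (rule mat_adjoint_carrier)
  have "mat_trace (mat_adjoint (embed d B A X) * \<rho>) = mat_trace (\<rho> * embed d B A (mat_adjoint X))"
    unfolding embed_adjoint[OF B X, symmetric] by (rule mat_trace_commute[of _ ?n ?n]) (use \<rho> in auto)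
  also have "\<dots> = mat_trace (mat_adjoint X * marginal d B \<rho> A)"
    unfolding mat_trace_mult_embed[OF B \<rho> X'] by (rule mat_trace_commute[of _ ?m ?m]) (use X' in auto)
  finally show ?thesis
    using B \<rho> \<sigma> X X'
    by (simp add: resolvent_functional_def embed_adjoint[symmetric] embed_mult[symmetric]
        mat_trace_mult_embed mult_carrier_mat[of _ ?m ?m])
qed

section \<open>Strong subadditivity of the entropy\<close>

lemma rel_entropy_marginal_le:
  assumes B: "finite B" "A \<subseteq> B"
    and pd: "positive_definite (hdim d B) \<rho>" "positive_definite (hdim d B) \<sigma>"
      "positive_definite (hdim d A) (marginal d B \<rho> A)" "positive_definite (hdim d A) (marginal d B \<sigma> A)"
  shows "rel_entropy (marginal d B \<rho> A) (marginal d B \<sigma> A) \<le> rel_entropy \<rho> \<sigma>"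
proof (rule rel_entropy_mono[OF pd])
  have c: "\<rho> \<in> op_on d B" "\<sigma> \<in> op_on d B" using pd by (auto simp: positive_definite_def)
  show "mat_trace \<rho> = mat_trace (marginal d B \<rho> A)"
    by (rule mat_trace_marginal[symmetric, OF B c(1)])
  show "\<exists>Y\<in>op_on d B. resolvent_functional \<rho> \<sigma> t Y
      = resolvent_functional (marginal d B \<rho> A) (marginal d B \<sigma> A) t X"
    if "X \<in> op_on d A" for t X
    using resolvent_functional_embed[OF B c that] embed_carrier by blast
qed

lemma mat_log_carrier:
  assumes "positive_definite n M"
  shows "mat_log M \<in> carrier_mat n n" "hermitian (mat_log M)"
proof -
  obtain U l where U: "unitary n U" and l: "\<And>i. i < n \<Longrightarrow> 0 < l i" and M: "M = spectral_mat n U l"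
    using positive_definite_decomposition[OF assms] by metis
  show "mat_log M \<in> carrier_mat n n" "hermitian (mat_log M)"
    using mat_log_spectral_mat[OF U, of l] l unitary_carrier[OF U]
    by (simp_all add: M hermitian_spectral_mat)
qed

text \<open>Monotonicity from \<open>A \<union> B \<union> C\<close> to \<open>A \<union> C\<close>,
  for the marginal of \<rho> against its marginal on \<open>B \<union> C\<close> extended by the
  identity. The relative entropies are \<open>S(B \<union> C) - S(A \<union> B \<union> C)\<close>
  before and \<open>S(C) - S(A \<union> C)\<close> after.\<close>

theorem entropy_strong_subadditivity:
  assumes V: "finite V" "A \<subseteq> V" "B \<subseteq> V" "C \<subseteq> V" and disj: "A \<inter> B = {}"
    and \<rho>: "\<rho> \<in> states d V"
  shows "0 \<le> cond_mutual_info d V \<rho> A B C"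
proof -
  let ?P = "A \<union> C" and ?Q = "B \<union> C"
  let ?W = "?P \<union> ?Q"
  have fin: "finite ?P" "finite ?Q" "finite ?W"
    using V finite_subset by (metis finite_UnI)+
  have PQ: "?P \<inter> ?Q = C" using disj by auto
  have W: "?W \<subseteq> V" using V by auto
  let ?m = "marginal d V \<rho>"
  have pd: "positive_definite (hdim d X) (?m X)" if "X \<subseteq> V" for X
    using marginal_in_states[OF V(1) that \<rho>] by (simp add: states_def)
  let ?\<sigma> = "embed d ?W ?Q (?m ?Q)"
  have \<sigma>P: "marginal d ?W ?\<sigma> ?P = embed d ?P C (?m C)"
    unfolding marginal_embed[OF fin(1,2)] PQ using V by (subst marginal_marginal) auto
  have \<rho>P: "marginal d ?W (?m ?W) ?P = ?m ?P"
    by (rule marginal_marginal[OF V(1) W]) auto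
  have "positive_definite (hdim d ?W) ?\<sigma>" "positive_definite (hdim d ?P) (embed d ?P C (?m C))"
    using V by (auto intro!: positive_definite_embed fin pd)
  then have "rel_entropy (?m ?P) (embed d ?P C (?m C)) \<le> rel_entropy (?m ?W) ?\<sigma>"
    using rel_entropy_marginal_le[OF fin(3), of ?P d "?m ?W" ?\<sigma>] pd W
    unfolding \<rho>P \<sigma>P by simp
  \<comment> \<open>The logarithm of the reference acts on \<open>Y\<close> alone, so its
    expectation is minus the entropy of the marginal there.\<close>
  moreover have "mat_trace (?m X * mat_log (embed d X Y (?m Y))) = mat_trace (?m Y * mat_log (?m Y))"
    if "Y \<subseteq> X" "X \<subseteq> V" for X Y
  proof -
    have Y: "Y \<subseteq> V" and X: "finite X" using that V finite_subset by auto
    show ?thesis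
      using pd[OF Y] mat_log_carrier(1)[OF pd[OF Y]] that
      by (simp add: mat_log_embed[OF X that(1)] mat_trace_mult_embed[OF X that(1)]
          marginal_marginal[OF V(1) that(2,1)])
  qed
  moreover have "A \<union> B \<union> C = ?W" by auto
  ultimately show ?thesis
    using V by (simp add: rel_entropy_def cond_mutual_info_def entropy_def)
qed

section \<open>Strong subadditivity and Markov properties\<close>

text \<open>Conditional mutual information of an arbitrary set function, so that the graph arguments
  see nothing of the operators.\<close>

definition cmi :: "('v set \<Rightarrow> real) \<Rightarrow> 'v set \<Rightarrow> 'v set \<Rightarrow> 'v set \<Rightarrow> real" where
  "cmi f A B C = f (A \<union> C) + f (B \<union> C) - f C - f (A \<union> B \<union> C)"

lemma cmi_commute: "cmi f A B C = cmi f B A C"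
  by (simp add: cmi_def Un_ac)

lemma cmi_chain: "cmi f (A \<union> A') B C = cmi f A B C + cmi f A' B (A \<union> C)"
proof -
  have "A \<union> A' \<union> C = A' \<union> (A \<union> C)" "B \<union> (A \<union> C) = A \<union> B \<union> C"
    "A' \<union> B \<union> (A \<union> C) = A \<union> A' \<union> B \<union> C"
    by auto
  then show ?thesis
    by (simp add: cmi_def)
qed

lemma cmi_chain_right: "cmi f A (B \<union> B') C = cmi f A B C + cmi f A B' (B \<union> C)"
  using cmi_chain[of f B B' A C] by (simp add: cmi_commute)

locale strong_subadditive =
  fixes V :: "'v set" and f :: "'v set \<Rightarrow> real"
  assumes cmi_nonneg: "\<lbrakk>A \<subseteq> V; B \<subseteq> V; C \<subseteq> V; A \<inter> B = {}; A \<inter> C = {}; B \<inter> C = {}\<rbrakk> \<Longrightarrow> 0 \<le> cmi f A B C"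
begin

lemma cmi_mono_right:
  assumes "A \<subseteq> V" "B \<subseteq> V" "C \<subseteq> V" "A \<inter> B = {}" "A \<inter> C = {}" "B \<inter> C = {}" "B' \<subseteq> B"
  shows "cmi f A B' C \<le> cmi f A B C"
proof -
  have "cmi f A B C = cmi f A B' C + cmi f A (B - B') (B' \<union> C)"
    using cmi_chain_right[of f A B' "B - B'" C] assms(7) by (simp add: Un_absorb1)
  moreover have "0 \<le> cmi f A (B - B') (B' \<union> C)"
    by (rule cmi_nonneg) (use assms in auto)
  ultimately show ?thesis by simp
qed

lemma cmi_mono:
  assumes "A \<subseteq> V" "B \<subseteq> V" "C \<subseteq> V" "A \<inter> B = {}" "A \<inter> C = {}" "B \<inter> C = {}" "A' \<subseteq> A" "B' \<subseteq> B"
  shows "cmi f A' B' C \<le> cmi f A B C"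
proof -
  have "cmi f A' B' C \<le> cmi f A' B C"
    by (rule cmi_mono_right) (use assms in auto)
  also have "\<dots> = cmi f B A' C" by (rule cmi_commute)
  also have "\<dots> \<le> cmi f B A C"
    by (rule cmi_mono_right) (use assms in auto)
  finally show ?thesis by (simp add: cmi_commute)
qed

text \<open>Decomposition and weak union in one step: the part of \<open>R\<close> inside
  \<open>D\<close> moves into the condition. The chain rule splits a quantity bounded by zero into
  two nonnegative terms.\<close>

lemma cmi_weak_union:
  assumes "A \<subseteq> V" "R \<subseteq> V" "P \<subseteq> V" "A \<inter> R = {}" "A \<inter> P = {}" "R \<inter> P = {}"
    and "cmi f A R P = 0" "P \<subseteq> D" "B \<union> D \<subseteq> R \<union> P" "B \<inter> D = {}"
  shows "cmi f A B D = 0"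
proof -
  have "cmi f A ((D - P) \<union> B) P \<le> cmi f A R P"
    by (rule cmi_mono_right) (use assms in auto)
  moreover have "cmi f A ((D - P) \<union> B) P = cmi f A (D - P) P + cmi f A B D"
    using assms(8) by (simp add: cmi_chain_right Un_absorb2)
  moreover have "0 \<le> cmi f A (D - P) P"
    by (rule cmi_nonneg) (use assms in auto)
  moreover have "0 \<le> cmi f A B D"
    by (rule cmi_nonneg) (use assms in auto)
  ultimately show ?thesis using assms(7) by simp
qed

end

text \<open>These sets stand in for initial segments of orderings: predecessor sets, nondescendant
  sets and ancestral closures are all of this kind, so one argument covers them.\<close>

definition ancestral :: "'v set \<Rightarrow> ('v \<times> 'v) set \<Rightarrow> 'v set \<Rightarrow> bool" where
  "ancestral V E A \<longleftrightarrow> A \<subseteq> V \<and> (\<forall>v\<in>A. parents E v \<subseteq> A)"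

lemma dag_irrefl: "dag V E \<Longrightarrow> (v, v) \<notin> E"
  by (auto simp: dag_def acyclic_def)

lemma dag_asym: "dag V E \<Longrightarrow> (u, v) \<in> E \<Longrightarrow> (v, u) \<notin> E"
  unfolding dag_def acyclic_def by (meson trancl.simps)

lemma dag_parents_subset: "dag V E \<Longrightarrow> parents E v \<subseteq> V - {v}"
  using dag_irrefl[of V E v] by (auto simp: dag_def parents_def)

lemma dag_sink:
  assumes "dag V E" "A \<noteq> {}"
  obtains v where "v \<in> A" "\<And>w. w \<in> A \<Longrightarrow> (v, w) \<notin> E"
proof -
  have "finite E"
    using assms(1) finite_subset[of E "V \<times> V"] by (auto simp: dag_def)
  then have "wf (E\<inverse>)"
    using assms(1) by (simp add: dag_def finite_acyclic_wf_converse)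
  from wfE_min'[OF this assms(2)] that show thesis by (metis converse.intros)
qed

locale strong_subadditive_dag = strong_subadditive V f
  for V :: "'v set" and f :: "'v set \<Rightarrow> real" +
  fixes E :: "('v \<times> 'v) set"
  assumes dag: "dag V E"
begin

abbreviation cost :: "'v \<Rightarrow> real" where
  "cost v \<equiv> f ({v} \<union> parents E v) - f (parents E v)"

text \<open>For a sink \<open>v\<close>, strong subadditivity of \<open>v\<close> against the rest
  given its parents says \<open>f A' - f (A' - {v}) \<le> cost v\<close>. Sinks of
  \<open>A' - A\<close> are removed until \<open>A\<close> is left.\<close>

lemma ancestral_increment:
  assumes "ancestral V E A" "ancestral V E A'" "A \<subseteq> A'"
  shows "f A' - f A \<le> (\<Sum>v\<in>A' - A. cost v)"
  using assms(2,3)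
proof (induction "card (A' - A)" arbitrary: A')
  case 0
  have "finite (A' - A)"
    using 0(2) dag finite_subset by (fastforce simp: ancestral_def dag_def)
  with 0 have "A' = A" by auto
  then show ?case by simp
next
  case (Suc k)
  have fin: "finite (A' - A)"
    using Suc(3) dag finite_subset by (fastforce simp: ancestral_def dag_def)
  from Suc(2) have "A' - A \<noteq> {}" by (metis card.empty nat.distinct(1))
  from dag_sink[OF dag this]
  obtain v where v: "v \<in> A' - A" and sink: "\<And>w. w \<in> A' - A \<Longrightarrow> (v, w) \<notin> E"
    by blast
  have pv: "parents E v \<subseteq> A' - {v}" "parents E v \<subseteq> V" "A' \<subseteq> V"
    using Suc(3) v dag_parents_subset[OF dag, of v] by (auto simp: ancestral_def)
  \<comment> \<open>A vertex of \<open>A\<close> cannot have \<open>v\<close> as a parent, since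
    \<open>A\<close> is ancestral and misses \<open>v\<close>; so the sink of the difference is a
    sink of all of \<open>A'\<close>.\<close>
  have "v \<notin> parents E w" if "w \<in> A'" for w
    using that sink[of w] v assms(1) by (cases "w \<in> A") (auto simp: ancestral_def parents_def)
  then have anc: "ancestral V E (A' - {v})"
    using Suc(3) by (auto simp: ancestral_def)
  have eq: "A' - {v} - A = A' - A - {v}" by auto
  have "k = card (A' - {v} - A)"
    unfolding eq using Suc(2) v fin by simp
  then have "f (A' - {v}) - f A \<le> (\<Sum>v\<in>A' - {v} - A. cost v)"
    using Suc(1)[of "A' - {v}"] anc v Suc(4) by auto
  moreover have "0 \<le> cmi f {v} (A' - {v} - parents E v) (parents E v)"
    by (rule cmi_nonneg) (use pv v in auto)
  moreover have "A' - {v} - parents E v \<union> parents E v = A' - {v}"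
    "{v} \<union> (A' - {v} - parents E v) \<union> parents E v = A'"
    using pv v by auto
  moreover have "(\<Sum>v\<in>A' - A. cost v) = cost v + (\<Sum>v\<in>A' - {v} - A. cost v)"
    unfolding eq by (rule sum.remove) (use v fin in auto)
  ultimately show ?case by (simp add: cmi_def)
qed

lemma ancestral_V: "ancestral V E V"
  using dag_parents_subset[OF dag] by (auto simp: ancestral_def)

lemma ancestral_empty: "ancestral V E {}"
  by (simp add: ancestral_def)

lemma total_le_cost: "f V - f {} \<le> (\<Sum>v\<in>V. cost v)"
  using ancestral_increment[OF ancestral_empty ancestral_V] by simp

end

section \<open>The case of equality\<close>

locale tight_dag = strong_subadditive_dag +
  assumes tight: "(\<Sum>v\<in>V. cost v) \<le> f V - f {}"
begin

text \<open>The empty set, \<open>A\<close>, \<open>insert v A\<close> and \<open>V\<close> form a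
  chain of ancestral sets. If the increments together reach the sum of all costs, none of them can
  fall short of its share, and for \<open>v\<close> this is the stated independence.\<close>

lemma tight_step:
  assumes A: "ancestral V E A" and v: "v \<in> V" "v \<notin> A" "parents E v \<subseteq> A"
  shows "cmi f {v} (A - parents E v) (parents E v) = 0"
proof -
  have A': "ancestral V E (insert v A)"
    using A v by (auto simp: ancestral_def)
  have fin: "finite V"
    using dag by (simp add: dag_def)
  have AV: "A \<subseteq> V" using A by (simp add: ancestral_def)
  have eq: "V - insert v A = V - A - {v}" by auto
  have "(\<Sum>v\<in>V. cost v) = (\<Sum>v\<in>A. cost v) + (\<Sum>v\<in>V - A. cost v)"
    using fin AV by (simp add: sum.subset_diff)
  also have "(\<Sum>v\<in>V - A. cost v) = cost v + (\<Sum>v\<in>V - insert v A. cost v)"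
    unfolding eq by (rule sum.remove) (use v fin in auto)
  finally have "cost v \<le> f (insert v A) - f A"
    using ancestral_increment[OF ancestral_empty A] ancestral_increment[OF A' ancestral_V]
      tight AV v by auto
  moreover have "0 \<le> cmi f {v} (A - parents E v) (parents E v)"
    by (rule cmi_nonneg) (use AV v in auto)
  moreover have "A - parents E v \<union> parents E v = A"
    "{v} \<union> (A - parents E v) \<union> parents E v = insert v A"
    using v by auto
  ultimately show ?thesis by (simp add: cmi_def)
qed

text \<open>An initial segment of a topological ordering is ancestral by transitivity, so one
  equality serves all orderings.\<close>

lemma cmi_predecessors:
  assumes r: "topological_ordering V E r" and v: "v \<in> V"
  shows "cmi f {v} (predecessors V r v - parents E v) (parents E v) = 0"
proof (rule tight_step[OF _ v])
  have tr: "trans r" and irr: "irrefl r" and sub: "E \<subseteq> r"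
    using r by (auto simp: topological_ordering_def strict_linear_order_on_def)
  have EV: "E \<subseteq> V \<times> V" using dag by (simp add: dag_def)
  show "ancestral V E (predecessors V r v)"
    using tr sub EV by (auto simp: ancestral_def predecessors_def parents_def dest: transD)
  show "v \<notin> predecessors V r v"
    using irr by (auto simp: predecessors_def irrefl_def)
  show "parents E v \<subseteq> predecessors V r v"
    using sub EV by (auto simp: predecessors_def parents_def)
qed

text \<open>A parent of a nondescendant is a nondescendant, and acyclicity puts the parents of
  \<open>v\<close> among them.\<close>

lemma cmi_nondescendants:
  assumes v: "v \<in> V"
  shows "cmi f {v} (nondescendants V E v - parents E v) (parents E v) = 0"
proof (rule tight_step[OF _ v])
  have EV: "E \<subseteq> V \<times> V" and acyc: "acyclic E" using dag by (auto simp: dag_def)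
  show "ancestral V E (nondescendants V E v)"
    using EV unfolding ancestral_def nondescendants_def parents_def descendants_def
    by (auto intro: trancl_into_trancl)
  show "v \<notin> nondescendants V E v"
    by (simp add: nondescendants_def)
  show "parents E v \<subseteq> nondescendants V E v"
    using EV acyc unfolding nondescendants_def parents_def descendants_def acyclic_def
    by (auto intro: trancl_into_trancl)
qed

text \<open>The last hypothesis says that no edge of the moral graph of \<open>A \<union> S \<union> B\<close> joins \<open>A\<close> to \<open>B\<close>.\<close>

lemma cmi_moral_separation:
  assumes "ancestral V E (A \<union> S \<union> B)" "A \<inter> B = {}" "A \<inter> S = {}" "B \<inter> S = {}"
    and "\<And>v. v \<in> A \<union> S \<union> B \<Longrightarrow>
      ({v} \<union> parents E v) \<inter> A = {} \<or> ({v} \<union> parents E v) \<inter> B = {}"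
  shows "cmi f A B S = 0"
  using assms
proof (induction "card (A \<union> S \<union> B)" arbitrary: A S B rule: less_induct)
  case less
  let ?W = "A \<union> S \<union> B"
  note disj = less(3-5) and family = less(6)
  have WV: "?W \<subseteq> V" using less(2) by (simp add: ancestral_def)
  have finW: "finite ?W" using WV dag finite_subset by (auto simp: dag_def)
  show ?case
  proof (cases "?W = {}")
    case False
    then obtain v where v: "v \<in> ?W" and sink: "\<And>w. w \<in> ?W \<Longrightarrow> (v, w) \<notin> E"
      using dag_sink[OF dag] by metis
    have pv: "parents E v \<subseteq> ?W - {v}"
      using less(2) v dag_parents_subset[OF dag, of v] by (auto simp: ancestral_def)
    have anc: "ancestral V E (?W - {v})"
      using less(2) sink by (auto simp: ancestral_def parents_def)
    \<comment> \<open>The only place in this induction where equality enters.\<close>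
    have v0: "cmi f {v} (?W - {v} - parents E v) (parents E v) = 0"
      by (rule tight_step[OF anc]) (use v WV pv in auto)
    have IH: "cmi f (A - {v}) (B - {v}) (S - {v}) = 0"
    proof (rule less(1))
      have eq: "A - {v} \<union> (S - {v}) \<union> (B - {v}) = ?W - {v}" by auto
      show "card (A - {v} \<union> (S - {v}) \<union> (B - {v})) < card ?W"
        unfolding eq by (rule card_Diff1_less[OF finW v])
      show "ancestral V E (A - {v} \<union> (S - {v}) \<union> (B - {v}))"
        unfolding eq by (rule anc)
      show "({u} \<union> parents E u) \<inter> (A - {v}) = {} \<or> ({u} \<union> parents E u) \<inter> (B - {v}) = {}"
        if "u \<in> A - {v} \<union> (S - {v}) \<union> (B - {v})" for u
        using family[of u] that by auto
    qed (use disj in auto)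
    have weak: "cmi f {v} X D = 0"
      if "parents E v \<subseteq> D" "X \<union> D \<subseteq> ?W - {v}" "X \<inter> D = {}" for X D
      by (rule cmi_weak_union[OF _ _ _ _ _ _ v0]) (use that pv v WV in auto)
    \<comment> \<open>If the sink \<open>v\<close> lies in \<open>X\<close> or in \<open>S\<close> and its family avoids \<open>Y\<close>, the chain rule transports
      the induction hypothesis.\<close>
    have step: "cmi f X Y S = 0"
      if XY: "X \<union> S \<union> Y = ?W" "X \<inter> Y = {}" "X \<inter> S = {}" "Y \<inter> S = {}"
        and fam: "({v} \<union> parents E v) \<inter> Y = {}"
        and ih: "cmi f (X - {v}) Y (S - {v}) = 0" for X Y
    proof (cases "v \<in> S")
      case True
      then have X: "X - {v} = X" and vX: "v \<notin> X" "v \<notin> Y" using XY by auto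
      \<comment> \<open>The parents of \<open>v\<close> avoid \<open>Y\<close>, so they lie in the
        condition \<open>X \<union> (S - {v})\<close>.\<close>
      have "cmi f {v} Y (X \<union> (S - {v})) = 0"
        by (rule weak) (use XY fam pv vX in auto)
      then have "cmi f ({v} \<union> X) Y (S - {v}) = 0"
        using ih X cmi_chain[of f X "{v}" Y "S - {v}"] by (simp add: Un_commute)
      \<comment> \<open>The same quantity expanded in the other order: the wanted term is one of two
        nonnegative terms with sum zero.\<close>
      then have "cmi f {v} Y (S - {v}) + cmi f X Y S = 0"
        using True cmi_chain[of f "{v}" X Y "S - {v}"] by (simp add: insert_absorb)
      moreover have "0 \<le> cmi f {v} Y (S - {v})"
        by (rule cmi_nonneg) (use XY vX WV True in auto)
      moreover have "0 \<le> cmi f X Y S"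
        by (rule cmi_nonneg) (use XY WV in auto)
      ultimately show ?thesis by simp
    next
      case False
      then have vX: "v \<in> X" "v \<notin> Y" using XY v fam by auto
      have "cmi f {v} Y ((X - {v}) \<union> S) = 0"
        by (rule weak) (use XY fam pv vX False in auto)
      moreover have "X - {v} \<union> {v} = X" using vX by auto
      ultimately show ?thesis
        using ih False cmi_chain[of f "X - {v}" "{v}" Y S] by simp
    qed
    from family[OF v] show ?thesis
    proof
      assume *: "({v} \<union> parents E v) \<inter> B = {}"
      then have "B - {v} = B" by auto
      then show ?thesis using step[of A B] disj * IH by auto
    next
      assume *: "({v} \<union> parents E v) \<inter> A = {}"
      then have A: "A - {v} = A" by auto
      have "B \<union> S \<union> A = ?W" by auto
      then have "cmi f B A S = 0"
        using step[of B A] disj * IH A by (simp add: cmi_commute Int_commute)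
      then show ?thesis by (simp add: cmi_commute)
    qed
  qed (simp add: cmi_def)
qed

end

section \<open>Active walks\<close>

lemma collider_butlast:
  assumes "Suc i < length w"
  shows "collider E (w @ us) i \<longleftrightarrow> collider E w i"
  using assms by (auto simp: collider_def nth_append)

lemma walk_snoc:
  assumes "walk V E w" "y \<in> V" "(last w, y) \<in> E \<or> (y, last w) \<in> E"
  shows "walk V E (w @ [y])"
proof -
  have ne: "w \<noteq> []" using assms(1) by (simp add: walk_def)
  have "((w @ [y]) ! i, (w @ [y]) ! Suc i) \<in> E \<or> ((w @ [y]) ! Suc i, (w @ [y]) ! i) \<in> E"
    if i: "Suc i < length (w @ [y])" for i
  proof (cases "Suc i < length w")
    case True
    then show ?thesis using assms(1) by (simp add: walk_def nth_append)
  next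
    case False
    with i have "i = length w - 1" "Suc i = length w" by auto
    then show ?thesis using assms(3) ne by (simp add: nth_append last_conv_nth)
  qed
  then show ?thesis using assms by (auto simp: walk_def)
qed

text \<open>Appending a vertex can change the collider status only of the former last vertex, which
  as an endpoint was a noncollider.\<close>

lemma active_snoc:
  assumes "w \<noteq> []" "active E S w" "y \<notin> S" "\<not> collider E (w @ [y]) (length w - 1)"
  shows "active E S (w @ [y])"
  unfolding active_def
proof (intro allI impI)
  fix i assume i: "i < length (w @ [y])"
  consider "Suc i < length w" | "i = length w - 1" | "i = length w"
    using i by fastforce
  then show "(\<not> collider E (w @ [y]) i \<longrightarrow> (w @ [y]) ! i \<notin> S) \<and>
      (collider E (w @ [y]) i \<longrightarrow> (w @ [y]) ! i \<in> S)"
  proof cases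
    case 1
    then show ?thesis
      using assms(2) collider_butlast[of i w E "[y]"] by (simp add: active_def nth_append)
  next
    case 2
    then have "\<not> collider E w i" "i < length w" using assms(1) by (auto simp: collider_def)
    then show ?thesis using assms(2,4) 2 by (auto simp: active_def nth_append)
  next
    case 3
    then show ?thesis using assms(3) by (auto simp: collider_def)
  qed
qed

definition active_walk ::
  "'v set \<Rightarrow> ('v \<times> 'v) set \<Rightarrow> 'v set \<Rightarrow> 'v set \<Rightarrow> 'v list \<Rightarrow> 'v \<Rightarrow> bool" where
  "active_walk V E A S w x \<longleftrightarrow> walk V E w \<and> hd w \<in> A \<and> last w = x \<and> active E S w"

text \<open>If the last arrow does not point into the final vertex, a further step to a parent
  creates no collider there. A walk with a single vertex qualifies.\<close>

definition ends_upward :: "('v \<times> 'v) set \<Rightarrow> 'v list \<Rightarrow> bool" where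
  "ends_upward E w \<longleftrightarrow> (2 \<le> length w \<longrightarrow> (w ! (length w - 2), last w) \<notin> E)"

text \<open>The outgoing arrow at \<open>x\<close> rules out a collider there, whichever way the
  walk arrived.\<close>

lemma active_walk_down:
  assumes "dag V E" "active_walk V E A S w x" "(x, y) \<in> E" "y \<notin> S"
  shows "active_walk V E A S (w @ [y]) y"
proof -
  have ne: "w \<noteq> []" using assms(2) by (auto simp: active_walk_def walk_def)
  have "y \<in> V" using assms(1,3) by (auto simp: dag_def)
  moreover have "\<not> collider E (w @ [y]) (length w - 1)"
    using dag_asym[OF assms(1,3)] assms(2) ne
    by (auto simp: collider_def active_walk_def nth_append last_conv_nth)
  ultimately show ?thesis
    using assms ne walk_snoc[of V E w y] active_snoc[OF ne, of E S y] by (auto simp: active_walk_def)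
qed

lemma active_walk_up:
  assumes "dag V E" "active_walk V E A S w x" "ends_upward E w" "(y, x) \<in> E" "y \<notin> S"
  shows "active_walk V E A S (w @ [y]) y" "ends_upward E (w @ [y])"
proof -
  have ne: "w \<noteq> []" using assms(2) by (auto simp: active_walk_def walk_def)
  have "y \<in> V" using assms(1,4) by (auto simp: dag_def)
  moreover have "\<not> collider E (w @ [y]) (length w - 1)"
    using assms(2,3) ne
    by (auto simp: collider_def active_walk_def ends_upward_def nth_append last_conv_nth
        numeral_2_eq_2 split: if_splits)
  ultimately show "active_walk V E A S (w @ [y]) y"
    using assms ne walk_snoc[of V E w y] active_snoc[OF ne, of E S y] by (auto simp: active_walk_def)
  show "ends_upward E (w @ [y])"
    using dag_asym[OF assms(1,4)] assms(2) ne
    by (auto simp: ends_upward_def active_walk_def nth_append last_conv_nth)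
qed

text \<open>The vertex \<open>s\<close> becomes a collider in \<open>S\<close>. The case
  \<open>y = x\<close> is included and lets a walk bounce off \<open>S\<close>, which relies on
  walks being allowed to repeat vertices.\<close>

lemma active_walk_collider:
  assumes "dag V E" "active_walk V E A S w x" "(x, s) \<in> E" "(y, s) \<in> E" "s \<in> S" "y \<notin> S"
  shows "active_walk V E A S (w @ [s, y]) y" "ends_upward E (w @ [s, y])"
proof -
  have ne: "w \<noteq> []" and lw: "last w = x" using assms(2) by (auto simp: active_walk_def walk_def)
  have V: "s \<in> V" "y \<in> V" using assms(1,3,4) by (auto simp: dag_def)
  have "walk V E ((w @ [s]) @ [y])"
    by (intro walk_snoc) (use assms V in \<open>auto simp: active_walk_def\<close>)
  moreover have "active E S (w @ [s, y])"
    unfolding active_def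
  proof (intro allI impI)
    fix i assume i: "i < length (w @ [s, y])"
    consider "Suc i < length w" | "i = length w - 1" | "i = length w" | "i = Suc (length w)"
      using i by fastforce
    then show "(\<not> collider E (w @ [s, y]) i \<longrightarrow> (w @ [s, y]) ! i \<notin> S) \<and>
        (collider E (w @ [s, y]) i \<longrightarrow> (w @ [s, y]) ! i \<in> S)"
    proof cases
      case 1
      then show ?thesis
        using assms(2) collider_butlast[of i w E "[s, y]"]
        by (simp add: active_walk_def active_def nth_append)
    next
      case 2
      have "\<not> collider E w i" "i < length w" using ne 2 by (auto simp: collider_def)
      then have "w ! i \<notin> S" using assms(2) by (auto simp: active_walk_def active_def)
      moreover have "\<not> collider E (w @ [s, y]) i"
        using dag_asym[OF assms(1,3)] ne lw 2
        by (auto simp: collider_def nth_append last_conv_nth)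
      ultimately show ?thesis using 2 ne by (simp add: nth_append)
    next
      case 3
      then have "collider E (w @ [s, y]) i"
        using assms(3,4) ne lw by (auto simp: collider_def nth_append last_conv_nth)
      then show ?thesis using 3 assms(5) by (simp add: nth_append)
    next
      case 4
      then show ?thesis using assms(6) by (auto simp: collider_def nth_append)
    qed
  qed
  ultimately show "active_walk V E A S (w @ [s, y]) y"
    using assms(2) ne by (auto simp: active_walk_def)
  show "ends_upward E (w @ [s, y])"
    using dag_asym[OF assms(1,4)] by (auto simp: ends_upward_def nth_append)
qed

text \<open>An active walk that enters \<open>v \<notin> S\<close> along an arrow cannot be continued to a parent of \<open>v\<close>.
  It is turned around by descending from \<open>v\<close> towards \<open>A \<union> B \<union> S\<close>: at the first vertex of \<open>S\<close> the walk
  makes a collider and climbs back, at a vertex of \<open>A\<close> a new walk is started, and \<open>B\<close> is excluded by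
  \<open>d\<close>-separation.\<close>

lemma active_walk_redirect:
  assumes "dag V E" "A \<subseteq> V" "A \<inter> S = {}" "d_separated V E A B S"
    and "(v, z) \<in> E\<^sup>*" "z \<in> A \<union> B \<union> S" "\<exists>w. active_walk V E A S w v" "v \<notin> S"
  shows "\<exists>w. active_walk V E A S w v \<and> ends_upward E w"
  using assms(5,7,8)
proof (induction rule: converse_rtrancl_induct)
  case base
  \<comment> \<open>The descent has ended at \<open>z\<close> itself: separation excludes
    \<open>B\<close>, and the assumption on the current vertex excludes \<open>S\<close>.\<close>
  then have "z \<notin> B"
    using assms(4) by (auto simp: d_separated_def active_walk_def)
  with base assms(6) have "z \<in> A" by auto
  then have "active_walk V E A S [z] z \<and> ends_upward E [z]"
    using assms(2,3)
    by (auto simp: active_walk_def walk_def active_def collider_def ends_upward_def)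
  then show ?case by blast
next
  case (step u u')
  then obtain w where w: "active_walk V E A S w u" by blast
  show ?case
  proof (cases "u' \<in> S")
    case True
    then show ?thesis
      using active_walk_collider[OF assms(1) w step(1) step(1)] step.prems by blast
  next
    case False
    \<comment> \<open>Descend to \<open>u'\<close>, turn around there, and climb the same arrow back
      to \<open>u\<close>.\<close>
    then have "\<exists>w. active_walk V E A S w u' \<and> ends_upward E w"
      using step.IH active_walk_down[OF assms(1) w step(1)] by blast
    then show ?thesis
      using active_walk_up[OF assms(1) _ _ step(1)] step.prems by blast
  qed
qed

section \<open>The global Markov property\<close>

context tight_dag
begin

text \<open>Inside the ancestral closure \<open>W\<close>, the set \<open>R\<close> reached from
  \<open>A\<close> by active walks is closed under moral adjacency outside \<open>S\<close>. So
  \<open>R\<close> and \<open>W - S - R\<close> enlarge \<open>A\<close> and \<open>B\<close> to a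
  pair that fills \<open>W\<close> together with \<open>S\<close>, as the separation lemma requires;
  monotonicity leads back to \<open>A\<close> and \<open>B\<close>.\<close>

lemma cmi_d_separated:
  assumes AV: "A \<subseteq> V" and BV: "B \<subseteq> V" and SV: "S \<subseteq> V"
    and disj: "A \<inter> B = {}" "A \<inter> S = {}" "B \<inter> S = {}" and sep: "d_separated V E A B S"
  shows "cmi f A B S = 0"
proof -
  define W where "W = {v. \<exists>z\<in>A \<union> B \<union> S. (v, z) \<in> E\<^sup>*}"
  define R where "R = {v \<in> W - S. \<exists>w. active_walk V E A S w v}"
  let ?R' = "W - S - R"
  have EV: "E \<subseteq> V \<times> V" using dag by (simp add: dag_def)
  have sub: "A \<union> B \<union> S \<subseteq> W" by (auto simp: W_def)
  have WV: "W \<subseteq> V"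
    using EV AV BV SV by (auto simp: W_def elim: converse_rtranclE)
  have anc: "ancestral V E W"
    using WV by (auto simp: ancestral_def parents_def W_def intro: converse_rtrancl_into_rtrancl)
  \<comment> \<open>The one closure property for which a walk may have to be turned around.\<close>
  have up: "u \<in> R" if "v \<in> R" "(u, v) \<in> E" "u \<notin> S" for u v
  proof -
    from that(1) obtain z where "(v, z) \<in> E\<^sup>*" "z \<in> A \<union> B \<union> S" by (auto simp: R_def W_def)
    with that(1) obtain w where "active_walk V E A S w v" "ends_upward E w"
      using active_walk_redirect[OF dag AV disj(2) sep] by (auto simp: R_def)
    then have "\<exists>w. active_walk V E A S w u"
      using active_walk_up(1)[OF dag _ _ that(2,3)] by blast
    moreover have "u \<in> W"
      using that anc by (auto simp: R_def ancestral_def parents_def)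
    ultimately show ?thesis using that(3) by (simp add: R_def)
  qed
  have down: "v \<in> R" if "u \<in> R" "(u, v) \<in> E" "v \<in> W" "v \<notin> S" for u v
    using that active_walk_down[OF dag _ that(2,4)] by (auto simp: R_def)
  have across: "y \<in> R" if "x \<in> R" "(x, s) \<in> E" "(y, s) \<in> E" "s \<in> S" "y \<in> W" "y \<notin> S" for x y s
    using that active_walk_collider(1)[OF dag _ that(2-4,6)] by (auto simp: R_def)
  have RS: "R \<subseteq> W" "R \<inter> S = {}" by (auto simp: R_def)
  have "cmi f R ?R' S = 0"
  proof (rule cmi_moral_separation)
    show "ancestral V E (R \<union> S \<union> ?R')"
      using anc sub by (simp add: R_def Un_absorb1 ancestral_def) blast
    fix v assume v: "v \<in> R \<union> S \<union> ?R'"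
    show "({v} \<union> parents E v) \<inter> R = {} \<or> ({v} \<union> parents E v) \<inter> ?R' = {}"
    proof (rule ccontr)
      assume "\<not> ?thesis"
      then obtain x y where x: "x = v \<or> (x, v) \<in> E" "x \<in> R" and y: "y = v \<or> (y, v) \<in> E" "y \<in> ?R'"
        by (auto simp: parents_def)
      \<comment> \<open>If the child \<open>v\<close> lies in \<open>S\<close>, it serves as a
        collider between \<open>x\<close> and \<open>y\<close>; otherwise \<open>v\<close> itself
        joins \<open>R\<close>, and then so does \<open>y\<close>.\<close>
      have "y \<in> R"
      proof (cases "v \<in> S")
        case True
        then show ?thesis using across[OF x(2), of v y] x y by (auto simp: R_def)
      next
        case False
        then have "v \<in> R" using x y v down[OF x(2), of v] by auto
        then show ?thesis using up[of v y] y by auto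
      qed
      with y show False by simp
    qed
  qed (auto simp: R_def)
  moreover have "A \<subseteq> R"
  proof
    fix a assume a: "a \<in> A"
    then have "active_walk V E A S [a] a"
      using AV disj by (auto simp: active_walk_def walk_def active_def collider_def)
    then show "a \<in> R" using a sub disj by (auto simp: R_def)
  qed
  moreover have "B \<subseteq> ?R'"
    using sub disj sep by (auto simp: R_def active_walk_def d_separated_def)
  ultimately have "cmi f A B S \<le> 0"
    using cmi_mono[of R ?R' S A B] WV SV RS by (simp add: subset_iff disjoint_iff)
  moreover have "0 \<le> cmi f A B S"
    by (rule cmi_nonneg) (use assms in auto)
  ultimately show ?thesis by simp
qed

end

section \<open>The Gibbs variational principle\<close>

lemma spectral_mat_one: "unitary n U \<Longrightarrow> spectral_mat n U (\<lambda>_. 1) = 1\<^sub>m n"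
  using unitary_carrier[of n U] by (simp add: spectral_mat_def unitary_mult_adjoint)

lemma spectral_mat_pow:
  assumes "unitary n U"
  shows "spectral_mat n U f ^\<^sub>m k = spectral_mat n U (\<lambda>i. f i ^ k)"
proof (induction k)
  case 0
  then show ?case using spectral_mat_one[OF assms] unitary_carrier[OF assms] by simp
next
  case (Suc k)
  then show ?case by (simp add: spectral_mat_mult[OF assms] mult.commute)
qed

text \<open>Powers act on the eigenvalues, so each entry of the series is a finite combination of
  scalar exponential series.\<close>

lemma mat_exp_spectral_mat:
  assumes "unitary n U"
  shows "mat_exp (spectral_mat n U f) = spectral_mat n U (\<lambda>i. exp (f i))"
proof (rule eq_matI)
  have U: "U \<in> carrier_mat n n" using assms by (rule unitary_carrier)
  fix i j
  assume "i < dim_row (spectral_mat n U (\<lambda>i. exp (f i)))" "j < dim_col (spectral_mat n U (\<lambda>i. exp (f i)))"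
  then have ij: "i < n" "j < n" using U by auto
  have "(\<lambda>k. complex_of_real (f m) ^ k / fact k) sums exp (complex_of_real (f m))" for m
    using exp_converges[of "complex_of_real (f m)"] by (simp add: scaleR_conv_of_real field_simps)
  then have "(\<lambda>k. \<Sum>m<n. U $$ (i, m) * cnj (U $$ (j, m)) * (complex_of_real (f m) ^ k / fact k))
      sums (\<Sum>m<n. U $$ (i, m) * cnj (U $$ (j, m)) * exp (complex_of_real (f m)))"
    by (intro sums_sum sums_mult)
  moreover have "(\<Sum>m<n. U $$ (i, m) * cnj (U $$ (j, m)) * (complex_of_real (f m) ^ k / fact k))
      = (spectral_mat n U f ^\<^sub>m k) $$ (i, j) / fact k" for k
    unfolding spectral_mat_pow[OF assms] index_spectral_mat[OF U ij] sum_divide_distrib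
    by (simp add: mult_ac)
  moreover have "(\<Sum>m<n. U $$ (i, m) * cnj (U $$ (j, m)) * exp (complex_of_real (f m)))
      = spectral_mat n U (\<lambda>i. exp (f i)) $$ (i, j)"
    unfolding index_spectral_mat[OF U ij] by (simp add: exp_of_real mult_ac)
  ultimately have "(\<lambda>k. (spectral_mat n U f ^\<^sub>m k) $$ (i, j) / fact k)
      sums spectral_mat n U (\<lambda>i. exp (f i)) $$ (i, j)"
    by simp
  then show "mat_exp (spectral_mat n U f) $$ (i, j) = spectral_mat n U (\<lambda>i. exp (f i)) $$ (i, j)"
    using ij U by (simp add: mat_exp_def sums_iff)
qed (use unitary_carrier[OF assms] in \<open>auto simp: mat_exp_def\<close>)

lemma mat_trace_mult_log_self:
  assumes "unitary n U" "\<And>i. i < n \<Longrightarrow> 0 < p i"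
  shows "Re (mat_trace (spectral_mat n U p * mat_log (spectral_mat n U p))) = (\<Sum>i<n. p i * ln (p i))"
  using assms by (simp add: mat_log_spectral_mat spectral_mat_mult mat_trace_spectral_mat)

text \<open>This is nonnegativity of the relative entropy to the normalised exponential. The doubly
  stochastic weights reduce it to \<open>ln x \<le> x - 1\<close> for pairs of eigenvalues.\<close>

lemma gibbs_variational_le:
  assumes \<rho>: "positive_definite n \<rho>" "mat_trace \<rho> = 1" and W: "unitary n W"
  shows "Re (mat_trace (\<rho> * spectral_mat n W h)) - Re (mat_trace (\<rho> * mat_log \<rho>))
    \<le> ln (\<Sum>j<n. exp (h j))"
proof -
  obtain U p where U: "unitary n U" and p: "\<And>i. i < n \<Longrightarrow> 0 < p i" and eq: "\<rho> = spectral_mat n U p"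
    using positive_definite_decomposition[OF \<rho>(1)] by metis
  have p1: "(\<Sum>i<n. p i) = 1"
    using \<rho>(2) unfolding eq mat_trace_spectral_mat[OF U] by (simp only: of_real_eq_1_iff)
  then have n: "0 < n" by (cases n) auto
  define c where "c = ln (\<Sum>j<n. exp (h j))"
  have "0 < (\<Sum>j<n. exp (h j))" using n by (intro sum_pos) auto
  then have c: "(\<Sum>j<n. exp (h j - c)) = 1"
    by (simp add: c_def exp_diff sum_divide_distrib[symmetric])
  have row: "(\<Sum>i<n. \<Sum>j<n. overlap U W i j * p i * g i) = (\<Sum>i<n. p i * g i)" for g
    using overlap_sum_right[OF U W] by (simp add: sum_distrib_right[symmetric] mult.assoc)
  have "Re (mat_trace (\<rho> * spectral_mat n W h)) - Re (mat_trace (\<rho> * mat_log \<rho>)) - c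
      = (\<Sum>i<n. \<Sum>j<n. overlap U W i j * p i * h j) - (\<Sum>i<n. p i * ln (p i)) - (\<Sum>i<n. p i * c)"
    using p p1 by (simp add: eq mat_trace_spectral_mat_mult[OF U W] mat_trace_mult_log_self[OF U, of p]
        sum_distrib_right[symmetric])
  also have "\<dots> = (\<Sum>i<n. \<Sum>j<n. overlap U W i j * (p i * (h j - c - ln (p i))))"
    unfolding row[symmetric] by (simp add: sum_subtractf[symmetric] algebra_simps)
  also have "\<dots> \<le> (\<Sum>i<n. \<Sum>j<n. overlap U W i j * (exp (h j - c) - p i))"
  proof (intro sum_mono mult_left_mono)
    fix i j assume "i \<in> {..<n}"
    then have pi: "0 < p i" using p by simp
    have "h j - c - ln (p i) = ln (exp (h j - c) / p i)"
      using pi by (simp add: ln_divide_pos)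
    also have "\<dots> \<le> exp (h j - c) / p i - 1"
      using pi by (intro ln_le_minus_one) simp
    finally show "p i * (h j - c - ln (p i)) \<le> exp (h j - c) - p i"
      using pi by (simp add: field_simps)
  qed simp
  also have "\<dots> = (\<Sum>i<n. \<Sum>j<n. overlap U W i j * exp (h j - c)) - (\<Sum>i<n. \<Sum>j<n. overlap U W i j * p i * 1)"
    by (simp add: right_diff_distrib sum_subtractf)
  \<comment> \<open>Row sums suffice for the terms in \<open>p\<close>; here the column sums
    enter.\<close>
  also have "(\<Sum>i<n. \<Sum>j<n. overlap U W i j * exp (h j - c))
      = (\<Sum>j<n. \<Sum>i<n. overlap U W i j * exp (h j - c))"
    by (rule sum.swap)
  also have "\<dots> = (\<Sum>j<n. exp (h j - c))"
    using overlap_sum_left[OF U W] by (simp add: sum_distrib_right[symmetric])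
  also have "(\<Sum>j<n. exp (h j - c)) - (\<Sum>i<n. \<Sum>j<n. overlap U W i j * p i * 1) = 0"
    unfolding row c using p1 by simp
  finally show ?thesis by (simp add: c_def)
qed

text \<open>The Gibbs state shares its eigenbasis with the generator, so both traces are sums over
  the same index and their difference collapses to \<open>c\<close>.\<close>

lemma gibbs_variational_attained:
  fixes h :: "nat \<Rightarrow> real"
  assumes W: "unitary n W" and n: "0 < n"
  defines "c \<equiv> ln (\<Sum>j<n. exp (h j))"
  defines "\<tau> \<equiv> spectral_mat n W (\<lambda>j. exp (h j - c))"
  shows "positive_definite n \<tau>" "mat_trace \<tau> = 1"
    "Re (mat_trace (\<tau> * spectral_mat n W h)) - Re (mat_trace (\<tau> * mat_log \<tau>)) = c"
proof -
  have "0 < (\<Sum>j<n. exp (h j))" using n by (intro sum_pos) auto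
  then have c: "(\<Sum>j<n. exp (h j - c)) = 1"
    by (simp add: c_def exp_diff sum_divide_distrib[symmetric])
  show "positive_definite n \<tau>"
    by (simp add: \<tau>_def positive_definite_spectral_mat_iff[OF W])
  show "mat_trace \<tau> = 1"
    unfolding \<tau>_def mat_trace_spectral_mat[OF W] c by simp
  have "Re (mat_trace (\<tau> * spectral_mat n W h)) - Re (mat_trace (\<tau> * mat_log \<tau>))
      = (\<Sum>j<n. exp (h j - c) * h j) - (\<Sum>j<n. exp (h j - c) * (h j - c))"
    by (simp add: \<tau>_def spectral_mat_mult[OF W] mat_trace_spectral_mat[OF W] mat_log_spectral_mat[OF W])
  also have "\<dots> = (\<Sum>j<n. exp (h j - c)) * c"
    by (simp add: right_diff_distrib sum_subtractf sum_distrib_right)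
  finally show "Re (mat_trace (\<tau> * spectral_mat n W h)) - Re (mat_trace (\<tau> * mat_log \<tau>)) = c"
    by (simp add: c)
qed

section \<open>The generator of the operator\<close>

definition T_gen :: "('v \<Rightarrow> nat) \<Rightarrow> 'v set \<Rightarrow> ('v \<times> 'v) set \<Rightarrow> complex mat \<Rightarrow> complex mat" where
  "T_gen d V E \<sigma> = mat (hdim d V) (hdim d V) (\<lambda>ij.
     \<Sum>v\<in>V. (log_marginal d V \<sigma> ({v} \<union> parents E v) - log_marginal d V \<sigma> (parents E v)) $$ ij)"

lemma T_gen_carrier [simp]: "T_gen d V E \<sigma> \<in> op_on d V"
  by (simp add: T_gen_def)

lemma log_marginal_carrier [simp]: "log_marginal d V \<sigma> A \<in> op_on d V"
  by (simp add: log_marginal_def)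

lemma T_op_eq: "T_op d V E \<sigma> = mat_exp (T_gen d V E \<sigma>)"
  by (simp add: T_op_def T_gen_def)

lemma state_positive_definite: "\<rho> \<in> states d V \<Longrightarrow> positive_definite (hdim d V) \<rho>"
  by (simp add: states_def)

lemma state_carrier: "\<rho> \<in> states d V \<Longrightarrow> \<rho> \<in> op_on d V"
  by (simp add: states_def positive_definite_def)

lemma hdim_pos_of_state: "\<rho> \<in> states d V \<Longrightarrow> 0 < hdim d V"
  by (rule ccontr) (auto simp: states_def positive_definite_def mat_trace_def)

lemma hermitian_log_marginal:
  assumes "finite V" "A \<subseteq> V" "\<sigma> \<in> states d V"
  shows "hermitian (log_marginal d V \<sigma> A)"
  using mat_log_carrier[OF state_positive_definite[OF marginal_in_states[OF assms]]] assms(1,2)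
  by (simp add: hermitian_def log_marginal_def embed_adjoint[symmetric])

lemma hermitian_T_gen:
  assumes "dag V E" "\<sigma> \<in> states d V"
  shows "hermitian (T_gen d V E \<sigma>)"
  unfolding hermitian_def
proof (rule eq_matI)
  have fin: "finite V" using assms(1) by (simp add: dag_def)
  fix i j assume "i < dim_row (T_gen d V E \<sigma>)" "j < dim_col (T_gen d V E \<sigma>)"
  then have ij: "i < hdim d V" "j < hdim d V" by (auto simp: T_gen_def)
  have L: "cnj (log_marginal d V \<sigma> A $$ (j, i)) = log_marginal d V \<sigma> A $$ (i, j)" if "A \<subseteq> V" for A
    using hermitian_log_marginal[OF fin that assms(2)] ij
      index_mat_adjoint[of i "log_marginal d V \<sigma> A" j] carrier_matD[OF log_marginal_carrier[of d V \<sigma> A]]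
    by (simp add: hermitian_def)
  have "parents E v \<subseteq> V" for v using dag_parents_subset[OF assms(1), of v] by auto
  then show "mat_adjoint (T_gen d V E \<sigma>) $$ (i, j) = T_gen d V E \<sigma> $$ (i, j)"
    using ij carrier_matD[OF log_marginal_carrier[of d V \<sigma>]]
    by (simp add: T_gen_def L)
qed (auto simp: T_gen_def)

text \<open>Linearity in the exponent, followed by duality: each logarithm sees only the matching
  marginal of \<rho>, so non-commuting terms never have to be combined.\<close>

lemma mat_trace_mult_T_gen:
  assumes "dag V E" "\<sigma> \<in> states d V" "\<rho> \<in> states d V"
  defines "l A \<equiv> Re (mat_trace (marginal d V \<rho> A * mat_log (marginal d V \<sigma> A)))"
  shows "Re (mat_trace (\<rho> * T_gen d V E \<sigma>)) = (\<Sum>v\<in>V. l ({v} \<union> parents E v) - l (parents E v))"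
proof -
  let ?n = "hdim d V" and ?L = "log_marginal d V \<sigma>"
  have fin: "finite V" using assms(1) by (simp add: dag_def)
  have \<rho>: "\<rho> \<in> op_on d V" using assms(3) by (rule state_carrier)
  have tr: "mat_trace (\<rho> * ?L A) = (\<Sum>i<?n. \<Sum>j<?n. \<rho> $$ (i, j) * ?L A $$ (j, i))" for A
    using \<rho> by (intro mat_trace_mult) auto
  have "mat_trace (\<rho> * T_gen d V E \<sigma>) = (\<Sum>i<?n. \<Sum>j<?n. \<rho> $$ (i, j) * T_gen d V E \<sigma> $$ (j, i))"
    using \<rho> by (intro mat_trace_mult) auto
  also have "\<dots> = (\<Sum>i<?n. \<Sum>j<?n. \<Sum>v\<in>V. \<rho> $$ (i, j) * ?L ({v} \<union> parents E v) $$ (j, i)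
      - \<rho> $$ (i, j) * ?L (parents E v) $$ (j, i))"
    using carrier_matD[OF log_marginal_carrier[of d V \<sigma>]]
    by (simp add: T_gen_def sum_distrib_left right_diff_distrib)
  also have "\<dots> = (\<Sum>i<?n. \<Sum>v\<in>V. \<Sum>j<?n. \<rho> $$ (i, j) * ?L ({v} \<union> parents E v) $$ (j, i)
      - \<rho> $$ (i, j) * ?L (parents E v) $$ (j, i))"
    by (intro sum.cong refl sum.swap)
  also have "\<dots> = (\<Sum>v\<in>V. \<Sum>i<?n. \<Sum>j<?n. \<rho> $$ (i, j) * ?L ({v} \<union> parents E v) $$ (j, i)
      - \<rho> $$ (i, j) * ?L (parents E v) $$ (j, i))"
    by (rule sum.swap)
  also have "\<dots> = (\<Sum>v\<in>V. mat_trace (\<rho> * ?L ({v} \<union> parents E v)) - mat_trace (\<rho> * ?L (parents E v)))"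
    by (simp add: tr sum_subtractf)
  finally have eq: "mat_trace (\<rho> * T_gen d V E \<sigma>)
    = (\<Sum>v\<in>V. mat_trace (\<rho> * ?L ({v} \<union> parents E v)) - mat_trace (\<rho> * ?L (parents E v)))" .
  have "Re (mat_trace (\<rho> * ?L A)) = l A" if "A \<subseteq> V" for A
    using mat_log_carrier(1)[OF state_positive_definite[OF marginal_in_states[OF fin that assms(2)]]]
    by (simp add: l_def log_marginal_def mat_trace_mult_embed[OF fin that \<rho>])
  moreover have "parents E v \<subseteq> V" for v using dag_parents_subset[OF assms(1), of v] by auto
  ultimately show ?thesis
    unfolding eq Re_sum by (intro sum.cong refl) simp
qed

text \<open>This removes the term of the empty set from the telescoped bound. A state on a
  one-dimensional space has the single eigenvalue 1.\<close>

lemma entropy_empty: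
  assumes "finite V" "\<rho> \<in> states d V"
  shows "entropy d V \<rho> {} = 0"
proof -
  let ?M = "marginal d V \<rho> {}"
  have st: "?M \<in> states d {}" by (rule marginal_in_states) (use assms in auto)
  have 1: "hdim d {} = 1" by (simp add: hdim_def cfg_def)
  obtain U l where U: "unitary 1 U" and l: "\<And>i. i < 1 \<Longrightarrow> 0 < l i" and M: "?M = spectral_mat 1 U l"
    using positive_definite_decomposition[of 1 ?M] state_positive_definite[OF st] unfolding 1 by metis
  have "l 0 = 1"
    using st mat_trace_spectral_mat[OF U, of l] by (simp add: M states_def)
  then show ?thesis
    unfolding entropy_def M using mat_trace_mult_log_self[OF U, of l] l by simp
qed

lemma cond_mutual_info_eq_cmi: "cond_mutual_info d V \<rho> A B C = cmi (entropy d V \<rho>) A B C"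
  by (simp add: cond_mutual_info_def cmi_def)

lemma strong_subadditive_dag_entropy:
  assumes "dag V E" "\<rho> \<in> states d V"
  shows "strong_subadditive_dag V (entropy d V \<rho>) E"
proof
  have fin: "finite V" using assms(1) by (simp add: dag_def)
  show "0 \<le> cmi (entropy d V \<rho>) A B C"
    if "A \<subseteq> V" "B \<subseteq> V" "C \<subseteq> V" "A \<inter> B = {}" for A B C
    using entropy_strong_subadditivity[OF fin that assms(2)] by (simp add: cond_mutual_info_eq_cmi)
qed (rule assms(1))

lemma mat_trace_mult_T_gen_le:
  assumes "dag V E" "\<sigma> \<in> states d V" "\<rho> \<in> states d V"
  shows "Re (mat_trace (\<rho> * T_gen d V E \<sigma>)) \<le> - (\<Sum>v\<in>V. cond_entropy d V \<rho> {v} (parents E v))"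
proof -
  have fin: "finite V" using assms(1) by (simp add: dag_def)
  define l where "l A = Re (mat_trace (marginal d V \<rho> A * mat_log (marginal d V \<sigma> A)))" for A
  have pd: "positive_definite (hdim d A) (marginal d V \<tau> A)" if "\<tau> \<in> states d V" "A \<subseteq> V" for \<tau> A
    using marginal_in_states[OF fin that(2,1)] by (rule state_positive_definite)
  have "l ({v} \<union> parents E v) - l (parents E v) \<le> - cond_entropy d V \<rho> {v} (parents E v)"
    if v: "v \<in> V" for v
  proof -
    let ?A = "parents E v" and ?B = "{v} \<union> parents E v"
    have sub: "?A \<subseteq> ?B" "?B \<subseteq> V" "?A \<subseteq> V" using v dag_parents_subset[OF assms(1), of v] by auto
    have mm: "marginal d ?B (marginal d V \<tau> ?B) ?A = marginal d V \<tau> ?A" for \<tau>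
      by (rule marginal_marginal[OF fin sub(2,1)])
    have "rel_entropy (marginal d V \<rho> ?A) (marginal d V \<sigma> ?A)
        \<le> rel_entropy (marginal d V \<rho> ?B) (marginal d V \<sigma> ?B)"
      using rel_entropy_marginal_le[OF finite_subset[OF sub(2) fin] sub(1),
          of d "marginal d V \<rho> ?B" "marginal d V \<sigma> ?B"]
      unfolding mm using pd[OF assms(2)] pd[OF assms(3)] sub by blast
    then show ?thesis
      by (simp add: rel_entropy_def l_def cond_entropy_def entropy_def)
  qed
  then have "(\<Sum>v\<in>V. l ({v} \<union> parents E v) - l (parents E v))
      \<le> (\<Sum>v\<in>V. - cond_entropy d V \<rho> {v} (parents E v))"
    by (rule sum_mono)
  then show ?thesis
    unfolding mat_trace_mult_T_gen[OF assms] l_def by (simp add: sum_negf)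
qed

lemma entropy_total:
  assumes "finite V" "\<rho> \<in> states d V"
  shows "entropy d V \<rho> V = - Re (mat_trace (\<rho> * mat_log \<rho>))"
  by (simp add: entropy_def marginal_self[OF assms(1) state_carrier[OF assms(2)]])

text \<open>Against \<sigma> itself the mixed terms are entropies, which is how
  \<open>excess_info\<close> enters the lower bound.\<close>

lemma mat_trace_mult_T_gen_self:
  assumes "dag V E" "\<sigma> \<in> states d V"
  shows "Re (mat_trace (\<sigma> * T_gen d V E \<sigma>)) = - (\<Sum>v\<in>V. cond_entropy d V \<sigma> {v} (parents E v))"
  unfolding mat_trace_mult_T_gen[OF assms assms(2)]
  by (simp add: cond_entropy_def entropy_def sum_negf[symmetric])

theorem theorem5p2:
  fixes V :: "'v set" and E :: "('v \<times> 'v) set" and d :: "'v \<Rightarrow> nat" and \<sigma> :: "complex mat"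
  assumes "dag V E" and "\<sigma> \<in> states d V"
  shows "complex_of_real (exp (- excess_info d V E \<sigma>)) \<le> mat_trace (T_op d V E \<sigma>)
    \<and> mat_trace (T_op d V E \<sigma>) \<le> 1
    \<and> (mat_trace (T_op d V E \<sigma>) = 1 \<longrightarrow>
         (\<forall>r. topological_ordering V E r \<longrightarrow> ordered_markov d V E r (T_op d V E \<sigma>))
         \<and> local_markov d V E (T_op d V E \<sigma>)
         \<and> global_markov d V E (T_op d V E \<sigma>))"
proof -
  let ?n = "hdim d V" and ?T = "T_op d V E \<sigma>" and ?H = "T_gen d V E \<sigma>"
  have fin: "finite V" using assms(1) by (simp add: dag_def)
  have n: "0 < ?n" by (rule hdim_pos_of_state[OF assms(2)])
  obtain W h where W: "unitary ?n W" and H: "?H = spectral_mat ?n W h"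
    using hermitian_spectral_decomposition[OF T_gen_carrier hermitian_T_gen[OF assms]] by metis
  define Z where "Z = (\<Sum>j<?n. exp (h j))"
  have T: "?T = spectral_mat ?n W (\<lambda>j. exp (h j))"
    by (simp add: T_op_eq H mat_exp_spectral_mat[OF W])
  have trT: "mat_trace ?T = complex_of_real Z"
    unfolding T mat_trace_spectral_mat[OF W] Z_def ..
  have Z: "0 < Z" unfolding Z_def using n by (intro sum_pos) auto
  have "- excess_info d V E \<sigma> = Re (mat_trace (\<sigma> * ?H)) - Re (mat_trace (\<sigma> * mat_log \<sigma>))"
    by (simp add: excess_info_def mat_trace_mult_T_gen_self[OF assms] entropy_total[OF fin assms(2)])
  also have "\<dots> \<le> ln Z"
    using gibbs_variational_le[OF state_positive_definite[OF assms(2)] _ W, of h] assms(2)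
    by (simp add: H Z_def states_def)
  finally have lower: "exp (- excess_info d V E \<sigma>) \<le> Z"
    using Z by (simp add: ln_ge_iff)
  \<comment> \<open>This is \<open>?T\<close> divided by its trace, a state whatever the trace
    is.\<close>
  define \<tau> where "\<tau> = spectral_mat ?n W (\<lambda>j. exp (h j - ln Z))"
  note gibbs = gibbs_variational_attained[OF W n, of h, folded Z_def, folded \<tau>_def]
  have \<tau>: "\<tau> \<in> states d V" using gibbs by (simp add: states_def)
  interpret strong_subadditive_dag V "entropy d V \<tau>" E
    by (rule strong_subadditive_dag_entropy[OF assms(1) \<tau>])
  have cost: "(\<Sum>v\<in>V. cond_entropy d V \<tau> {v} (parents E v)) = (\<Sum>v\<in>V. cost v)"
    by (simp add: cond_entropy_def)
  have "ln Z = Re (mat_trace (\<tau> * ?H)) + entropy d V \<tau> V"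
    using gibbs(3) by (simp add: H entropy_total[OF fin \<tau>])
  also have "\<dots> \<le> entropy d V \<tau> V - (\<Sum>v\<in>V. cost v)"
    using mat_trace_mult_T_gen_le[OF assms \<tau>] unfolding cost by simp
  finally have lnZ: "ln Z \<le> entropy d V \<tau> V - (\<Sum>v\<in>V. cost v)" .
  moreover have "entropy d V \<tau> V \<le> (\<Sum>v\<in>V. cost v)"
    using total_le_cost by (simp add: entropy_empty[OF fin \<tau>])
  ultimately have "ln Z \<le> 0" by linarith
  then have upper: "Z \<le> 1" using Z by (simp only: ln_le_zero_iff)
  have markov: "(\<forall>r. topological_ordering V E r \<longrightarrow> ordered_markov d V E r ?T)
      \<and> local_markov d V E ?T \<and> global_markov d V E ?T" if "Z = 1"
  proof -
    have "?T = \<tau>" using that by (simp add: T \<tau>_def)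
    \<comment> \<open>With \<open>ln Z = 0\<close> the estimates behind the upper bound close up, so
      the entropy of \<open>\<tau>\<close> meets the sum of its conditional entropies.\<close>
    moreover have "(\<Sum>v\<in>V. cost v) \<le> entropy d V \<tau> V - entropy d V \<tau> {}"
      using lnZ that by (simp add: entropy_empty[OF fin \<tau>])
    then interpret tight_dag V "entropy d V \<tau>" E
      by unfold_locales
    have "(\<forall>r. topological_ordering V E r \<longrightarrow> ordered_markov d V E r \<tau>)
      \<and> local_markov d V E \<tau> \<and> global_markov d V E \<tau>"
      unfolding ordered_markov_def local_markov_def global_markov_def cond_indep_def
        cond_mutual_info_eq_cmi
      using cmi_predecessors cmi_nondescendants cmi_d_separated by blast
    ultimately show ?thesis by simp
  qed
  show ?thesis
    using lower upper markov unfolding trT by (auto simp: less_eq_complex_def)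
qed

end
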